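(* Let $\mathcal{H}$ be a real Hilbert space, $A:\mathcal{H}\rightrightarrows\mathcal{H}$ a maximally monotone operator, $D:\mathcal{H}\to\mathcal{H}$ an $\eta$-cocoercive operator with $\eta>0$, $B:\mathcal{H}\to\mathcal{H}$ a $\mu$-cocoercive operator with $\mu>0$, and suppose that $C=\operatorname{zer}B\neq\emptyset$. Let $\lambda,\beta:[0,+\infty)\to(0,+\infty)$ be continuous on each interval $[0,b]$, $0<b<+\infty$. Then for every $x_0\in\mathcal{H}$ there exists a unique strong global solution $x:[0,+\infty)\to\mathcal{H}$ of the dynamical system $$\dot x(t)+x(t)=J_{\lambda(t)A}\big(x(t)-\lambda(t)Dx(t)-\lambda(t)\beta(t)Bx(t)\big),\qquad x(0)=x_0 .$$
   Context: $M:\mathcal{H}\rightrightarrows\mathcal{H}$ is monotone if $\langle x-y,u-v\rangle\ge 0$ whenever $u\in Mx$, $v\in My$, and maximally monotone if moreover its graph has no proper monotone extension in $\mathcal{H}\times\mathcal{H}$. The resolvent is $J_M=(\operatorname{Id}+M)^{-1}$, which is single-valued and everywhere defined when $M$ is maximally monotone. $\operatorname{zer}M=\{x:0\in Mx\}$. A single-valued $M:\mathcal{H}\to\mathcal{H}$ is $\gamma$-cocoercive if $\langle x-y,Mx-My\rangle\ge\gamma\|Mx-My\|^2$ for all $x,y\in\mathcal{H}$. A function $f:[0,b]\to\mathcal{H}$ is absolutely continuous if there is an integrable $g:[0,b]\to\mathcal{H}$ with $f(t)=f(0)+\int_0^t g(s)\,ds$ for all $t\in[0,b]$. A strong global solution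 of the dynamical system is a function $x:[0,+\infty)\to\mathcal{H}$ that is absolutely continuous on each $[0,b]$, $0<b<+\infty$, satisfies the differential equation for almost every $t\in[0,+\infty)$, and satisfies $x(0)=x_0$. *)

theory Defs
  imports "HOL-Analysis.Analysis"
begin

section \<open>Set-valued operators\<close>

text \<open>
  A set-valued operator on \<^typ>\<open>'a\<close> is a function \<^typ>\<open>'a \<Rightarrow> 'a set\<close>; a single-valued
  operator \<open>T\<close> is regarded as the set-valued operator \<open>\<lambda>x. {T x}\<close>.
\<close>

definition graph_op :: "('a \<Rightarrow> 'a set) \<Rightarrow> ('a \<times> 'a) set" where
  "graph_op M = {(x, u). u \<in> M x}"

definition inverse_op :: "('a \<Rightarrow> 'a set) \<Rightarrow> 'a \<Rightarrow> 'a set" where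
  "inverse_op M u = {x. u \<in> M x}"

definition plus_op :: "('a::real_vector \<Rightarrow> 'a set) \<Rightarrow> ('a \<Rightarrow> 'a set) \<Rightarrow> 'a \<Rightarrow> 'a set" where
  "plus_op M N x = {u + v | u v. u \<in> M x \<and> v \<in> N x}"

definition scale_op :: "real \<Rightarrow> ('a::real_vector \<Rightarrow> 'a set) \<Rightarrow> 'a \<Rightarrow> 'a set" where
  "scale_op c M x = {c *\<^sub>R u | u. u \<in> M x}"

definition zer :: "('a::real_vector \<Rightarrow> 'a set) \<Rightarrow> 'a set" where
  "zer M = {x. 0 \<in> M x}"

definition monotone_op :: "('a::real_inner \<Rightarrow> 'a set) \<Rightarrow> bool" where
  "monotone_op M \<longleftrightarrow> (\<forall>x y. \<forall>u\<in>M x. \<forall>v\<in>M y. (x - y) \<bullet> (u - v) \<ge> 0)"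

definition maximally_monotone :: "('a::real_inner \<Rightarrow> 'a set) \<Rightarrow> bool" where
  "maximally_monotone M \<longleftrightarrow>
     monotone_op M \<and> \<not> (\<exists>N. monotone_op N \<and> graph_op M \<subset> graph_op N)"

definition cocoercive :: "real \<Rightarrow> ('a::real_inner \<Rightarrow> 'a) \<Rightarrow> bool" where
  "cocoercive \<gamma> T \<longleftrightarrow> (\<forall>x y. (x - y) \<bullet> (T x - T y) \<ge> \<gamma> * (norm (T x - T y))\<^sup>2)"

text \<open>The resolvent is kept set-valued; \<open>J z = p\<close> is written \<open>resolvent M z = {p}\<close>.\<close>

definition resolvent :: "('a::real_vector \<Rightarrow> 'a set) \<Rightarrow> 'a \<Rightarrow> 'a set" where
  "resolvent M = inverse_op (plus_op (\<lambda>x. {x}) M)"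

section \<open>The Bochner integral without separability\<close>

text \<open>
  The library's \<^const>\<open>has_bochner_integral\<close> is restricted to second countable spaces, which
  would exclude non-separable Hilbert spaces.  Here its Borel measurability requirement is
  replaced by strong measurability: almost everywhere, the approximating simple functions
  converge pointwise to the integrand.
\<close>

definition has_strong_bochner_integral ::
    "'m measure \<Rightarrow> ('m \<Rightarrow> 'a::real_normed_vector) \<Rightarrow> 'a \<Rightarrow> bool" where
  "has_strong_bochner_integral M f I \<longleftrightarrow>
     (\<exists>s. (\<forall>i. Bochner_Integration.simple_bochner_integrable M (s i)) \<and>
          (AE x in M. (\<lambda>i. s i x) \<longlonglongrightarrow> f x) \<and>
          (\<lambda>i. \<integral>\<^sup>+x. ennreal (norm (f x - s i x)) \<partial>M) \<longlonglongrightarrow> 0 \<and>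
          (\<lambda>i. Bochner_Integration.simple_bochner_integral M (s i)) \<longlonglongrightarrow> I)"

section \<open>Strong global solutions\<close>

text \<open>
  Integrability of \<open>g\<close> on \<open>{0..b}\<close> is the instance \<open>t = b\<close>.
\<close>

definition abs_cont_upto :: "real \<Rightarrow> (real \<Rightarrow> 'a::real_normed_vector) \<Rightarrow> bool" where
  "abs_cont_upto b f \<longleftrightarrow>
     (\<exists>g. \<forall>t\<in>{0..b}. has_strong_bochner_integral (lebesgue_on {0..t}) g (f t - f 0))"

text \<open>
  Trajectories on the half-line are functions on \<^typ>\<open>real\<close> of which only the values on
  \<open>{0..}\<close> are used.
\<close>

definition strong_global_solution ::
    "('a::real_inner \<Rightarrow> 'a set) \<Rightarrow> ('a \<Rightarrow> 'a) \<Rightarrow> ('a \<Rightarrow> 'a) \<Rightarrow>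
     (real \<Rightarrow> real) \<Rightarrow> (real \<Rightarrow> real) \<Rightarrow> 'a \<Rightarrow> (real \<Rightarrow> 'a) \<Rightarrow> bool" where
  "strong_global_solution A D B lam \<beta> x0 x \<longleftrightarrow>
     (\<forall>b>0. abs_cont_upto b x) \<and>
     (AE t in lebesgue_on {0..}.
        \<exists>v. (x has_vector_derivative v) (at t within {0..}) \<and>
            resolvent (scale_op (lam t) A)
              (x t - lam t *\<^sub>R D (x t) - (lam t * \<beta> t) *\<^sub>R B (x t)) = {v + x t}) \<and>
     x 0 = x0"

end

theory Submission
  imports Defs
begin

text \<open>
  By Minty's theorem the resolvents \<open>J c\<close> of \<open>c *\<^sub>R A\<close> are single-valued and everywhere defined; it is
  proved here by minimising the Fitzpatrick function plus half the squared norm over \<open>'a \<times> 'a\<close>, where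
  strong convexity makes every minimising sequence Cauchy.  Monotonicity makes \<open>J c z\<close> nonexpansive
  in \<open>z\<close> and continuous in \<open>c\<close>, and cocoercive maps are Lipschitz, so the system reads
  \<open>x' t = F t (x t)\<close> with \<open>F\<close> continuous in \<open>t\<close> and Lipschitz in the second argument with a constant
  depending continuously on \<open>t\<close>.  Existence is Picard's theorem.  For two solutions,
  \<open>exp (- 2 * M * t) * (norm (x t - y t))\<^sup>2\<close> is absolutely continuous with nonpositive derivative almost
  everywhere, hence nonincreasing.
\<close>

section \<open>Resolvents of maximally monotone operators\<close>

text \<open>The Fitzpatrick function dominates the pairing of \<open>x\<close> with
  \<open>u\<close>, so adding half the squared norm of \<open>(x, u)\<close> leaves at least half of
  \<open>(norm (x + u))\<^sup>2\<close>. This explains both the lower bound needed for minimising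
  and why the minimiser ends up on the antidiagonal \<open>u = - x\<close>, which is what
  surjectivity of the identity plus the operator asks for.

  On the analytic side the obstacle is that the equation holds only almost everywhere. A derivative
  that is nonpositive almost everywhere does not make a continuous function nonincreasing, as the
  Cantor function shows. What excludes such behaviour is a real integrable function whose integrals
  dominate all increments. The space may be non-separable, so this function is extracted from the
  strong integral through norms and inner products with fixed vectors, which are real integrals.
  Conversely, Picard's solution is continuously differentiable, but it must still be exhibited as a
  strong integral, and this is done with explicit step functions.\<close>

lemma convex_minimiser_exists:
  fixes S :: "('b::{real_inner, complete_space} \<times> real) set"
  assumes "convex S" "closed S" "S \<noteq> {}"
    and bdd: "\<And>z r. (z, r) \<in> S \<Longrightarrow> c \<le> r + (norm z)\<^sup>2 / 2"
  obtains z r where "(z, r) \<in> S"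
    and "\<And>z' r'. (z', r') \<in> S \<Longrightarrow> r + (norm z)\<^sup>2 / 2 \<le> r' + (norm z')\<^sup>2 / 2"
proof -
  define \<phi> where "\<phi> p = snd p + (norm (fst p))\<^sup>2 / 2" for p :: "'b \<times> real"
  define m where "m = Inf (\<phi> ` S)"
  have below: "bdd_below (\<phi> ` S)"
    using bdd by (force simp: \<phi>_def intro!: bdd_belowI[of _ c])
  have m_le: "m \<le> \<phi> p" if "p \<in> S" for p
    unfolding m_def using that below by (intro cInf_lower) auto
  have "\<exists>p\<in>S. \<phi> p < m + 1 / Suc n" for n
  proof -
    have "Inf (\<phi> ` S) < m + 1 / Suc n" by (simp add: m_def)
    then show ?thesis using cInf_lessD[of "\<phi> ` S"] \<open>S \<noteq> {}\<close> by blast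
  qed
  then obtain p where pS: "\<And>n. p n \<in> S" and p_less: "\<And>n. \<phi> (p n) < m + 1 / Suc n"
    by metis
  \<comment> \<open>Strong convexity through the parallelogram identity: the value at the midpoint
    is below the average by one eighth of the squared distance of the first components, yet it is at
    least \<open>m\<close>.\<close>
  have mid: "(norm (fst p - fst q))\<^sup>2 \<le> 4 * (\<phi> p + \<phi> q - 2 * m)" if "p \<in> S" "q \<in> S" for p q
  proof -
    let ?h = "(1/2) *\<^sub>R p + (1/2) *\<^sub>R q"
    have "?h \<in> S" using \<open>convex S\<close> that by (intro convexD) auto
    then have "m \<le> \<phi> ?h" by (rule m_le)
    moreover have "\<phi> ?h = (\<phi> p + \<phi> q) / 2 - (norm (fst p - fst q))\<^sup>2 / 8"
      by (simp add: \<phi>_def power2_norm_eq_inner inner_add_left inner_add_right inner_diff_left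
          inner_diff_right inner_commute field_simps)
    moreover have "n \<le> 4 * (a + b - 2 * m)" if "m \<le> (a + b) / 2 - n / 8" for a b n :: real
      using that by (simp add: field_simps)
    ultimately show ?thesis by metis
  qed
  have "Cauchy (\<lambda>n. fst (p n))"
  proof (rule metric_CauchyI)
    fix e :: real assume "e > 0"
    obtain M where M: "8 / e\<^sup>2 < real M" using reals_Archimedean2 by blast
    have "dist (fst (p i)) (fst (p j)) < e" if "i \<ge> M" "j \<ge> M" for i j
    proof -
      have "0 < 8 / e\<^sup>2" using \<open>e > 0\<close> by simp
      then have "M > 0" using M by (meson less_trans of_nat_0_less_iff)
      have "1 / Suc i \<le> 1 / M" "1 / Suc j \<le> 1 / M"
        using that \<open>M > 0\<close> by (auto intro!: divide_left_mono)
      then have "\<phi> (p i) + \<phi> (p j) - 2 * m < 2 / M"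
        using p_less[of i] p_less[of j] by simp
      then have "(norm (fst (p i) - fst (p j)))\<^sup>2 < 8 / M"
        using mid[OF pS pS, of i j] by simp
      also have "\<dots> < e\<^sup>2" using M \<open>e > 0\<close> \<open>M > 0\<close> by (simp add: field_simps)
      finally show ?thesis using \<open>e > 0\<close> by (simp add: dist_norm power2_less_imp_less)
    qed
    then show "\<exists>M. \<forall>i\<ge>M. \<forall>j\<ge>M. dist (fst (p i)) (fst (p j)) < e" by blast
  qed
  then obtain z where z: "(\<lambda>n. fst (p n)) \<longlonglongrightarrow> z"
    using Cauchy_convergent convergent_def by blast
  have \<phi>_lim: "(\<lambda>n. \<phi> (p n)) \<longlonglongrightarrow> m"
  proof (rule tendsto_sandwich[of "\<lambda>_. m" _ _ "\<lambda>n. m + 1 / Suc n"])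
    show "(\<lambda>n. m + 1 / real (Suc n)) \<longlonglongrightarrow> m"
      using tendsto_add[OF tendsto_const LIMSEQ_inverse_real_of_nat, of m]
      by (simp add: inverse_eq_divide)
  qed (use m_le pS p_less in \<open>auto intro!: always_eventually less_imp_le\<close>)
  \<comment> \<open>The distance estimate controls first components only. The second components
    converge because the values \<open>\<phi> (p n)\<close> and the norms both do.\<close>
  define r where "r = m - (norm z)\<^sup>2 / 2"
  have "(\<lambda>n. \<phi> (p n) - (norm (fst (p n)))\<^sup>2 / 2) \<longlonglongrightarrow> r"
    unfolding r_def by (intro tendsto_intros \<phi>_lim z) simp
  then have "(\<lambda>n. snd (p n)) \<longlonglongrightarrow> r" by (simp add: \<phi>_def)
  then have "(\<lambda>n. (fst (p n), snd (p n))) \<longlonglongrightarrow> (z, r)" by (intro tendsto_Pair z)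
  then have "(z, r) \<in> S"
    using \<open>closed S\<close> pS by (auto simp: closed_sequential_limits)
  moreover have "r + (norm z)\<^sup>2 / 2 \<le> r' + (norm z')\<^sup>2 / 2" if "(z', r') \<in> S" for z' r'
    using m_le[OF that] by (simp add: r_def \<phi>_def)
  ultimately show ?thesis by (rule that)
qed

text \<open>First-order optimality: compare the minimiser with the point a fraction \<open>t\<close>
  of the way to \<open>(z', r')\<close>, divide by \<open>t\<close> and let \<open>t\<close> tend to
  0. The quadratic remainder still carries a factor \<open>t\<close> and disappears.\<close>

lemma convex_minimiser_variational:
  fixes S :: "('b::real_inner \<times> real) set"
  assumes "convex S" "(z, r) \<in> S" "(z', r') \<in> S"
    and min: "\<And>z' r'. (z', r') \<in> S \<Longrightarrow> r + (norm z)\<^sup>2 / 2 \<le> r' + (norm z')\<^sup>2 / 2"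
  shows "r \<le> r' + z \<bullet> (z' - z)"
proof (rule ccontr)
  assume "\<not> ?thesis"
  then have neg: "r' - r + z \<bullet> (z' - z) < 0" (is "?d < 0") by simp
  have key: "0 \<le> ?d + t * ((norm (z' - z))\<^sup>2 / 2)" if t: "0 < t" "t \<le> 1" for t
  proof -
    have "(1 - t) *\<^sub>R (z, r) + t *\<^sub>R (z', r') \<in> S"
      using assms(1-3) t by (intro convexD) auto
    moreover have "(1 - t) *\<^sub>R (z, r) + t *\<^sub>R (z', r') = (z + t *\<^sub>R (z' - z), r + t * (r' - r))"
      by (simp add: algebra_simps)
    ultimately have "r + (norm z)\<^sup>2 / 2 \<le> r + t * (r' - r) + (norm (z + t *\<^sub>R (z' - z)))\<^sup>2 / 2"
      using min by metis
    also have "(norm (z + t *\<^sub>R (z' - z)))\<^sup>2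
        = (norm z)\<^sup>2 + 2 * t * (z \<bullet> (z' - z)) + t * t * (norm (z' - z))\<^sup>2"
      unfolding power2_norm_eq_inner
      by (simp add: inner_add_left inner_add_right inner_commute algebra_simps)
    finally have "r + (norm z)\<^sup>2 / 2 \<le> r + t * (r' - r)
        + ((norm z)\<^sup>2 + 2 * t * (z \<bullet> (z' - z)) + t * t * (norm (z' - z))\<^sup>2) / 2" .
    moreover have "0 \<le> t * (\<rho> + i + t * (N / 2))"
      if "r + n / 2 \<le> r + t * \<rho> + (n + 2 * t * i + t * t * N) / 2" for n \<rho> i N :: real
      using that by (simp add: field_simps)
    ultimately have "0 \<le> t * (?d + t * ((norm (z' - z))\<^sup>2 / 2))" by metis
    then show ?thesis using t by (simp add: zero_le_mult_iff)
  qed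
  have "((\<lambda>t. ?d + t * ((norm (z' - z))\<^sup>2 / 2)) \<longlongrightarrow> ?d + 0 * ((norm (z' - z))\<^sup>2 / 2)) (at_right 0)"
    by (intro tendsto_intros)
  moreover have "\<forall>\<^sub>F t in at_right 0. 0 \<le> ?d + t * ((norm (z' - z))\<^sup>2 / 2)"
    unfolding eventually_at_right_field by (rule exI[of _ 1]) (use key in auto)
  ultimately have "0 \<le> ?d + 0 * ((norm (z' - z))\<^sup>2 / 2)"
    by (rule tendsto_lowerbound) simp
  then show False using neg by simp
qed

text \<open>
  \<open>S\<close> is the epigraph of the Fitzpatrick function of \<open>G\<close>; working with the epigraph avoids
  extended real values.
\<close>

lemma Minty_graph:
  fixes G :: "('a::{real_inner, complete_space} \<times> 'a) set"
  assumes mono: "\<And>a u b v. (a, u) \<in> G \<Longrightarrow> (b, v) \<in> G \<Longrightarrow> 0 \<le> (a - b) \<bullet> (u - v)"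
    and max: "\<And>x u. (\<And>a v. (a, v) \<in> G \<Longrightarrow> 0 \<le> (x - a) \<bullet> (u - v)) \<Longrightarrow> (x, u) \<in> G"
  shows "\<exists>x. (x, - x) \<in> G"
proof -
  define S where "S = {((x, u), r) | x u r. \<forall>(a, v)\<in>G. x \<bullet> v + a \<bullet> u - a \<bullet> v \<le> r}"
  have S_iff: "((x, u), r) \<in> S \<longleftrightarrow> (\<forall>a v. (a, v) \<in> G \<longrightarrow> x \<bullet> v + a \<bullet> u - a \<bullet> v \<le> r)" for x u r
    by (auto simp: S_def)
  have S_Inter: "S = (\<Inter>g\<in>G. {p. fst (fst p) \<bullet> snd g + fst g \<bullet> snd (fst p) - fst g \<bullet> snd g \<le> snd p})"
  proof (rule set_eqI)
    fix p :: "('a \<times> 'a) \<times> real"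
    obtain x u r where "p = ((x, u), r)" by (metis surj_pair)
    then show "p \<in> S \<longleftrightarrow> p \<in> (\<Inter>g\<in>G. {p. fst (fst p) \<bullet> snd g + fst g \<bullet> snd (fst p) - fst g \<bullet> snd g \<le> snd p})"
      by (auto simp: S_iff)
  qed
  have "closed S"
    unfolding S_Inter
    by (intro closed_INT ballI closed_Collect_le continuous_intros)
  have "convex S"
    unfolding convex_alt
  proof clarify
    fix x u r x' u' r' t assume *: "((x, u), r) \<in> S" "((x', u'), r') \<in> S" "0 \<le> t" "t \<le> (1::real)"
    show "(1 - t) *\<^sub>R ((x, u), r) + t *\<^sub>R ((x', u'), r') \<in> S"
      unfolding scaleR_Pair add_Pair S_iff
    proof clarify
      fix a v assume "(a, v) \<in> G"
      then have "x \<bullet> v + a \<bullet> u - a \<bullet> v \<le> r" "x' \<bullet> v + a \<bullet> u' - a \<bullet> v \<le> r'"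
        using * by (auto simp: S_iff)
      then have "(1 - t) * (x \<bullet> v + a \<bullet> u - a \<bullet> v) + t * (x' \<bullet> v + a \<bullet> u' - a \<bullet> v)
          \<le> (1 - t) * r + t * r'"
        using * by (intro add_mono mult_left_mono) auto
      then show "((1 - t) *\<^sub>R x + t *\<^sub>R x') \<bullet> v + a \<bullet> ((1 - t) *\<^sub>R u + t *\<^sub>R u') - a \<bullet> v
          \<le> (1 - t) *\<^sub>R r + t *\<^sub>R r'"
        by (simp add: inner_add_left inner_add_right algebra_simps)
    qed
  qed
  have G_S: "((a, v), a \<bullet> v) \<in> S" if "(a, v) \<in> G" for a v
    using mono[OF that] by (auto simp: S_iff inner_diff_left inner_diff_right algebra_simps)
  \<comment> \<open>The bound contributed by \<open>(a, v)\<close> equals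
    \<open>x \<bullet> u - (x - a) \<bullet> (u - v)\<close>. On the graph take
    \<open>(a, v) = (x, u)\<close>; off the graph maximality supplies a pair whose product is
    negative.\<close>
  have S_lower: "x \<bullet> u \<le> r" if "((x, u), r) \<in> S" for x u r
  proof (cases "(x, u) \<in> G")
    case True
    then show ?thesis using that by (fastforce simp: S_iff)
  next
    case False
    then obtain a v where "(a, v) \<in> G" "(x - a) \<bullet> (u - v) < 0"
      using max[of x u] by force
    then show ?thesis using that by (force simp: S_iff inner_diff_left inner_diff_right)
  qed
  have "G \<noteq> {}" using max[of 0 0] by blast
  then have "S \<noteq> {}" using G_S by force
  have bdd: "0 \<le> r + (norm z)\<^sup>2 / 2" if "(z, r) \<in> S" for z r
  proof -
    obtain x u where z: "z = (x, u)" by force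
    have "0 \<le> (norm (x + u))\<^sup>2" by simp
    also have "\<dots> = (norm z)\<^sup>2 + 2 * (x \<bullet> u)"
      by (simp add: z power2_norm_eq_inner inner_add_left inner_add_right inner_commute)
    finally show ?thesis using S_lower that z by force
  qed
  obtain z r where zr: "(z, r) \<in> S"
    and min: "\<And>z' r'. (z', r') \<in> S \<Longrightarrow> r + (norm z)\<^sup>2 / 2 \<le> r' + (norm z')\<^sup>2 / 2"
    using convex_minimiser_exists[OF \<open>convex S\<close> \<open>closed S\<close> \<open>S \<noteq> {}\<close> bdd] by blast
  obtain x u where z: "z = (x, u)" by force
  \<comment> \<open>The variational inequality against a graph point, combined with
    \<open>x \<bullet> u \<le> r\<close>, completes to a product in which the swapped pair
    \<open>(- u, - x)\<close> appears. Its nonnegativity puts that pair into \<open>G\<close>, and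
    testing the pair against itself then forces \<open>x + u = 0\<close>.\<close>
  have key: "(norm (x + u))\<^sup>2 \<le> (- u - a) \<bullet> (- x - v)" if "(a, v) \<in> G" for a v
  proof -
    have "r \<le> a \<bullet> v + z \<bullet> ((a, v) - z)"
      using convex_minimiser_variational[OF \<open>convex S\<close> zr G_S[OF that] min] .
    moreover have "x \<bullet> u \<le> r" using zr z S_lower by simp
    ultimately show ?thesis
      by (simp add: z power2_norm_eq_inner inner_add_left inner_add_right inner_diff_left
          inner_diff_right inner_commute)
  qed
  then have "(- u, - x) \<in> G" by (intro max) (meson order_trans zero_le_power2)
  with key[OF this] have "u = - x" by (simp add: eq_neg_iff_add_eq_0 add.commute)
  with \<open>(- u, - x) \<in> G\<close> show ?thesis by auto
qed

section \<open>From Minty's theorem to single-valued resolvents\<close>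

lemma maximally_monotone_memI:
  assumes "maximally_monotone A"
    and rel: "\<And>a v. v \<in> A a \<Longrightarrow> 0 \<le> (x - a) \<bullet> (u - v)"
  shows "u \<in> A x"
proof (rule ccontr)
  assume "u \<notin> A x"
  define N where "N = A(x := insert u (A x))"
  have mono: "monotone_op A" using assms(1) by (simp add: maximally_monotone_def)
  have "monotone_op N"
    unfolding monotone_op_def
  proof (intro allI ballI)
    fix a b v w assume *: "v \<in> N a" "w \<in> N b"
    have N: "v \<in> N a \<longleftrightarrow> v \<in> A a \<or> a = x \<and> v = u" for a v by (auto simp: N_def)
    have "0 \<le> (a - x) \<bullet> (v - u)" if "v \<in> A a" for a v
      using rel[OF that] by (simp add: inner_diff_left inner_diff_right)
    then show "0 \<le> (a - b) \<bullet> (v - w)"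
      using * mono rel unfolding N monotone_op_def by auto
  qed
  moreover have "graph_op A \<subset> graph_op N"
    using \<open>u \<notin> A x\<close> by (force simp: graph_op_def N_def)
  ultimately show False using assms(1) by (auto simp: maximally_monotone_def)
qed

lemma maximally_monotone_range:
  fixes A :: "'a::{real_inner, complete_space} \<Rightarrow> 'a set"
  assumes "maximally_monotone A" "c > 0"
  shows "\<exists>p u. u \<in> A p \<and> z = p + c *\<^sub>R u"
proof -
  \<comment> \<open>This is the graph of \<open>c A - z\<close>; a point \<open>(x, - x)\<close> of
    it solves the inclusion of \<open>z\<close> in \<open>x + c A x\<close>.\<close>
  define G where "G = {(a, c *\<^sub>R v - z) | a v. v \<in> A a}"
  have mono: "monotone_op A" using assms(1) by (simp add: maximally_monotone_def)
  have "\<exists>x. (x, - x) \<in> G"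
  proof (rule Minty_graph)
    fix a u b v assume "(a, u) \<in> G" "(b, v) \<in> G"
    then obtain u' v' where "u' \<in> A a" "v' \<in> A b" "u = c *\<^sub>R u' - z" "v = c *\<^sub>R v' - z"
      by (auto simp: G_def)
    moreover from this have "0 \<le> (a - b) \<bullet> (u' - v')" using mono by (auto simp: monotone_op_def)
    moreover have "c *\<^sub>R u' - z - (c *\<^sub>R v' - z) = c *\<^sub>R (u' - v')" by (simp add: algebra_simps)
    ultimately show "0 \<le> (a - b) \<bullet> (u - v)" using \<open>c > 0\<close> by simp
  next
    fix x u assume *: "\<And>a v. (a, v) \<in> G \<Longrightarrow> 0 \<le> (x - a) \<bullet> (u - v)"
    have "(1 / c) *\<^sub>R (u + z) \<in> A x"
    proof (rule maximally_monotone_memI[OF assms(1)])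
      fix a v assume "v \<in> A a"
      then have "0 \<le> (x - a) \<bullet> (u - (c *\<^sub>R v - z))" by (intro *) (auto simp: G_def)
      also have "u - (c *\<^sub>R v - z) = c *\<^sub>R ((1 / c) *\<^sub>R (u + z) - v)"
        using \<open>c > 0\<close> by (simp add: algebra_simps)
      finally show "0 \<le> (x - a) \<bullet> ((1 / c) *\<^sub>R (u + z) - v)"
        using \<open>c > 0\<close> by (simp add: zero_le_mult_iff)
    qed
    then show "(x, u) \<in> G"
      using \<open>c > 0\<close> by (force simp: G_def)
  qed
  then obtain p v where "v \<in> A p" "- p = c *\<^sub>R v - z" by (auto simp: G_def)
  then show ?thesis by (intro exI[of _ p] exI[of _ v]) (simp add: algebra_simps)
qed

lemma resolvent_scale_op_iff:
  "p \<in> resolvent (scale_op c A) z \<longleftrightarrow> (\<exists>u. u \<in> A p \<and> z = p + c *\<^sub>R u)"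
  by (auto simp: resolvent_def inverse_op_def plus_op_def scale_op_def)

text \<open>Monotonicity is tested with \<open>p - q\<close> after expressing
  \<open>c (u - v)\<close> through the two resolvent arguments. The estimate serves three purposes:
  equal arguments and parameters give uniqueness, equal parameters give nonexpansiveness, and
  different parameters give continuity in the parameter. Only \<open>norm v\<close> enters, so with
  the second point held fixed no control of \<open>u\<close> is required.\<close>

lemma resolvent_perturbation:
  assumes "monotone_op A" "c > 0" and "u \<in> A p" "v \<in> A q"
  shows "norm (p - q) \<le> norm ((p + c *\<^sub>R u) - (q + d *\<^sub>R v)) + \<bar>d - c\<bar> * norm v"
proof -
  let ?w = "(p + c *\<^sub>R u) - (q + d *\<^sub>R v)"
  have "0 \<le> (p - q) \<bullet> (u - v)" using assms by (auto simp: monotone_op_def)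
  then have "0 \<le> (p - q) \<bullet> (c *\<^sub>R (u - v))" using \<open>c > 0\<close> by simp
  also have "c *\<^sub>R (u - v) = ?w + (d - c) *\<^sub>R v - (p - q)" by (simp add: algebra_simps)
  finally have "(norm (p - q))\<^sup>2 \<le> (p - q) \<bullet> (?w + (d - c) *\<^sub>R v)"
    by (simp only: inner_diff_right[of "p - q" _ "p - q"] power2_norm_eq_inner diff_ge_0_iff_ge)
  also have "\<dots> \<le> norm (p - q) * norm (?w + (d - c) *\<^sub>R v)" by (rule norm_cauchy_schwarz)
  finally have "norm (p - q) \<le> norm (?w + (d - c) *\<^sub>R v)"
    by (cases "p = q") (auto simp: power2_eq_square)
  also have "\<dots> \<le> norm ?w + \<bar>d - c\<bar> * norm v"
    by (rule norm_triangle_le) simp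
  finally show ?thesis .
qed

lemma resolvent_singleton:
  fixes A :: "'a::{real_inner, complete_space} \<Rightarrow> 'a set"
  assumes "maximally_monotone A" "c > 0"
  shows "\<exists>p. resolvent (scale_op c A) z = {p}"
proof -
  obtain p u where pu: "u \<in> A p" "z = p + c *\<^sub>R u"
    using maximally_monotone_range[OF assms] by blast
  have "q = p" if q: "q \<in> resolvent (scale_op c A) z" for q
  proof -
    obtain v where "v \<in> A q" "z = q + c *\<^sub>R v" using q unfolding resolvent_scale_op_iff by blast
    then show ?thesis
      using resolvent_perturbation[of A c u p v q c] assms pu by (simp add: maximally_monotone_def)
  qed
  then show ?thesis using pu resolvent_scale_op_iff by (intro exI[of _ p]) blast
qed

lemma cocoercive_lipschitz:
  assumes "cocoercive \<gamma> T" "\<gamma> > 0"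
  shows "norm (T x - T y) \<le> norm (x - y) / \<gamma>"
proof -
  have "\<gamma> * (norm (T x - T y))\<^sup>2 \<le> (x - y) \<bullet> (T x - T y)" using assms by (simp add: cocoercive_def)
  also have "\<dots> \<le> norm (x - y) * norm (T x - T y)" by (rule norm_cauchy_schwarz)
  finally have "\<gamma> * norm (T x - T y) \<le> norm (x - y)"
    by (cases "T x = T y") (auto simp: power2_eq_square)
  then show ?thesis using assms(2) by (simp add: field_simps)
qed

section \<open>Global solutions of Lipschitz differential equations\<close>

text \<open>
  Sort inference does not put a type of sort \<open>{real_normed_vector, complete_space}\<close> into the class
  \<^class>\<open>banach\<close>, so results about Banach spaces are applied to a copy of the type.
\<close>

typedef 'a banach_copy = "UNIV :: 'a set"
  morphisms of_copy to_copy ..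

setup_lifting type_definition_banach_copy

instantiation banach_copy :: (real_vector) real_vector
begin

lift_definition zero_banach_copy :: "'a banach_copy" is 0 .
lift_definition plus_banach_copy :: "'a banach_copy \<Rightarrow> 'a banach_copy \<Rightarrow> 'a banach_copy" is "(+)" .
lift_definition minus_banach_copy :: "'a banach_copy \<Rightarrow> 'a banach_copy \<Rightarrow> 'a banach_copy" is "(-)" .
lift_definition uminus_banach_copy :: "'a banach_copy \<Rightarrow> 'a banach_copy" is "uminus" .
lift_definition scaleR_banach_copy :: "real \<Rightarrow> 'a banach_copy \<Rightarrow> 'a banach_copy" is "scaleR" .

instance
  by standard (transfer; simp add: algebra_simps)+

end

instantiation banach_copy :: (real_normed_vector) real_normed_vector
begin

lift_definition norm_banach_copy :: "'a banach_copy \<Rightarrow> real" is norm .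
lift_definition dist_banach_copy :: "'a banach_copy \<Rightarrow> 'a banach_copy \<Rightarrow> real" is dist .
lift_definition sgn_banach_copy :: "'a banach_copy \<Rightarrow> 'a banach_copy" is sgn .
definition uniformity_banach_copy :: "('a banach_copy \<times> 'a banach_copy) filter" where
  "uniformity_banach_copy = (INF e\<in>{0<..}. principal {(x, y). dist x y < e})"
definition open_banach_copy :: "'a banach_copy set \<Rightarrow> bool" where
  "open_banach_copy U \<longleftrightarrow> (\<forall>x\<in>U. \<forall>\<^sub>F (x', y) in uniformity. x' = x \<longrightarrow> y \<in> U)"

instance
proof
  fix x y :: "'a banach_copy" and a :: real
  show "dist x y = norm (x - y)" by transfer (rule dist_norm)
  show "sgn x = x /\<^sub>R norm x" by transfer (rule sgn_div_norm)
  show "norm x = 0 \<longleftrightarrow> x = 0" by transfer simp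
  show "norm (x + y) \<le> norm x + norm y" by transfer (rule norm_triangle_ineq)
  show "norm (a *\<^sub>R x) = \<bar>a\<bar> * norm x" by transfer simp
qed (rule uniformity_banach_copy_def open_banach_copy_def)+

end

instance banach_copy :: ("{real_normed_vector, complete_space}") banach
proof
  fix X :: "nat \<Rightarrow> 'a banach_copy"
  assume "Cauchy X"
  then have "Cauchy (\<lambda>n. of_copy (X n))"
    unfolding Cauchy_def by (simp add: dist_banach_copy.rep_eq)
  then obtain l where "(\<lambda>n. of_copy (X n)) \<longlonglongrightarrow> l"
    using Cauchy_convergent convergent_def by blast
  then have "X \<longlonglongrightarrow> to_copy l"
    by (simp add: lim_sequentially dist_banach_copy.rep_eq to_copy_inverse)
  then show "convergent X" by (auto simp: convergent_def)
qed

lemma bounded_linear_of_copy: "bounded_linear of_copy"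
  by (rule bounded_linear_intro[of _ 1])
    (simp_all add: plus_banach_copy.rep_eq scaleR_banach_copy.rep_eq norm_banach_copy.rep_eq)

lemma bounded_linear_to_copy: "bounded_linear to_copy"
  by (rule bounded_linear_intro[of _ 1])
    (simp_all add: plus_banach_copy.abs_eq scaleR_banach_copy.abs_eq norm_banach_copy.abs_eq)

section \<open>Picard's theorem on the half-line\<close>

lemma antiderivative_halfline:
  fixes f :: "real \<Rightarrow> 'b::banach"
  assumes "continuous_on {0..} f" "t \<ge> 0"
  shows "((\<lambda>u. integral {0..u} f) has_vector_derivative f t) (at t within {0..})"
proof -
  have "((\<lambda>u. integral {0..u} f) has_vector_derivative f t) (at t within {0..t + 1})"
    using assms by (intro integral_has_vector_derivative) (auto intro: continuous_on_subset)
  also have "at t within {0..t + 1} = at t within {0..}"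
    using assms(2) by (intro at_within_nhd[of _ "{t - 1<..<t + 1}"]) auto
  finally show ?thesis .
qed

text \<open>Freeze the second argument at \<open>y t\<close>: at time \<open>s\<close> the Lipschitz
  bound controls the change from \<open>y s\<close> to \<open>y t\<close>, uniformly enough because
  \<open>L s\<close> converges to \<open>L t\<close>, and continuity in time does the rest.\<close>

lemma continuous_on_lipschitz_family:
  fixes F :: "real \<Rightarrow> 'b::real_normed_vector \<Rightarrow> 'c::real_normed_vector"
  assumes contF: "\<And>y. continuous_on S (\<lambda>t. F t y)" and contL: "continuous_on S L"
    and lip: "\<And>t y z. t \<in> S \<Longrightarrow> norm (F t y - F t z) \<le> L t * norm (y - z)"
    and conty: "continuous_on S y"
  shows "continuous_on S (\<lambda>t. F t (y t))"
  unfolding continuous_on_def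
proof
  fix t assume t: "t \<in> S"
  have y: "(y \<longlongrightarrow> y t) (at t within S)" and L: "(L \<longlongrightarrow> L t) (at t within S)"
    using conty contL t by (auto simp: continuous_on_def)
  have "((\<lambda>s. L s * norm (y s - y t)) \<longlongrightarrow> 0) (at t within S)"
    using tendsto_mult[OF L tendsto_norm[OF tendsto_diff[OF y tendsto_const[of "y t"]]]] by simp
  then have "((\<lambda>s. F s (y s) - F s (y t)) \<longlongrightarrow> 0) (at t within S)"
    by (rule Lim_null_comparison[rotated]) (use lip in \<open>auto simp: eventually_at_filter\<close>)
  moreover have "((\<lambda>s. F s (y t)) \<longlongrightarrow> F t (y t)) (at t within S)"
    using contF t by (auto simp: continuous_on_def)
  ultimately show "((\<lambda>s. F s (y s)) \<longlongrightarrow> F t (y t)) (at t within S)"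
    using tendsto_add by fastforce
qed

text \<open>
  The Picard operator contracts in the norm \<open>sup exp (- P t) * norm (x t)\<close>, where \<open>P' = 2 * L\<close>;
  the fixed point therefore lives on the whole half-line at once.  Bounded continuous functions on
  \<^typ>\<open>real\<close> that are constant on the negative half-line stand for functions on \<open>{0..}\<close>.
\<close>

lemma global_picard_banach:
  fixes F :: "real \<Rightarrow> 'b::banach \<Rightarrow> 'b"
  assumes contF: "\<And>y. continuous_on {0..} (\<lambda>t. F t y)"
    and contL: "continuous_on {0..} L"
    and lip: "\<And>t y z. t \<ge> 0 \<Longrightarrow> norm (F t y - F t z) \<le> L t * norm (y - z)"
  shows "\<exists>x. x 0 = x0 \<and> (\<forall>t\<ge>0. (x has_vector_derivative F t (x t)) (at t within {0..}))"
proof -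
  \<comment> \<open>Adding the size of \<open>F t 0\<close> to the Lipschitz bound lets one weight
    do two jobs: it makes the Picard operator contract and it keeps the image of the zero function
    bounded. The absolute value makes \<open>K\<close> nonnegative at every
    \<open>t\<close>.\<close>
  define K where "K t = \<bar>L t\<bar> + norm (F t 0)" for t
  have contK: "continuous_on {0..} K"
    unfolding K_def by (intro continuous_intros contL contF)
  have K_nonneg: "K t \<ge> 0" for t by (simp add: K_def)
  \<comment> \<open>The factor 2 becomes the contraction constant 1/2, since the integral of
    \<open>K * E\<close> is then \<open>(E t - 1) / 2\<close>.\<close>
  define P where "P t = 2 * integral {0..t} K" for t
  define E where "E t = exp (P t)" for t
  have E_pos: "E t > 0" for t by (simp add: E_def)
  have E_ge_1: "E t \<ge> 1" for t
  proof -
    have "integral {0..t} K \<ge> 0"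
      by (intro Henstock_Kurzweil_Integration.integral_nonneg integrable_continuous_real
          continuous_on_subset[OF contK] K_nonneg) auto
    then show ?thesis by (simp add: E_def P_def)
  qed
  have P_deriv: "(P has_vector_derivative 2 * K t) (at t within {0..})" if "t \<ge> 0" for t
    using antiderivative_halfline[OF contK that, THEN has_vector_derivative_mult_right, of 2]
    by (simp add: P_def[abs_def])
  have E_deriv: "(E has_vector_derivative 2 * K t * E t) (at t within {0..})" if "t \<ge> 0" for t
    using P_deriv[OF that] unfolding E_def[abs_def] has_real_derivative_iff_has_vector_derivative[symmetric]
    by (auto intro!: derivative_eq_intros)
  have contE: "continuous_on {0..} E"
    by (rule continuous_on_vector_derivative) (use E_deriv in auto)
  have KE_int: "((\<lambda>s. K s * E s) has_integral (E t - 1) / 2) {0..t}" if "t \<ge> 0" for t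
  proof -
    have "((\<lambda>s. 2 * K s * E s) has_integral (E t - E 0)) {0..t}"
      using that E_deriv
      by (intro fundamental_theorem_of_calculus) (auto intro: has_vector_derivative_within_subset[OF E_deriv])
    from has_integral_mult_right[OF this, of "1/2"] show ?thesis
      by (simp add: E_def P_def mult_ac)
  qed
  \<comment> \<open>The Picard operator written for \<open>z = x / E\<close>: the weighted supremum
    norm of \<open>x\<close> is the ordinary supremum norm of \<open>z\<close>, for which bounded
    continuous functions form a complete space.\<close>
  define T where "T z t = (1 / E t) *\<^sub>R (x0 + integral {0..t} (\<lambda>s. F s (E s *\<^sub>R z s)))"
    for z :: "real \<Rightarrow> 'b" and t
  have cont_rhs: "continuous_on {0..} (\<lambda>s. F s (E s *\<^sub>R z s))" if "continuous_on {0..} z" for z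
    by (intro continuous_on_lipschitz_family[OF contF contL lip] continuous_intros contE that) auto
  have intg: "(\<lambda>s. F s (E s *\<^sub>R z s)) integrable_on {0..t}" if "continuous_on {0..} z" for z t
    by (intro integrable_continuous_real continuous_on_subset[OF cont_rhs[OF that]]) auto
  have T_contr: "norm (T z t - T w t) \<le> c / 2"
    if z: "continuous_on {0..} z" and w: "continuous_on {0..} w" and "t \<ge> 0" and c: "\<And>s. norm (z s - w s) \<le> c"
    for z w t c
  proof -
    have "c \<ge> 0" using c[of 0] norm_ge_zero order_trans by blast
    have "norm (integral {0..t} (\<lambda>s. F s (E s *\<^sub>R z s) - F s (E s *\<^sub>R w s)))
        \<le> integral {0..t} (\<lambda>s. K s * E s * c)"
    proof (rule integral_norm_bound_integral)
      fix s assume s: "s \<in> {0..t}"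
      have "norm (F s (E s *\<^sub>R z s) - F s (E s *\<^sub>R w s)) \<le> L s * norm (E s *\<^sub>R z s - E s *\<^sub>R w s)"
        using lip s by simp
      also have "\<dots> = L s * (E s * norm (z s - w s))"
        using E_pos[of s] by (simp flip: scaleR_diff_right)
      also have "\<dots> \<le> K s * (E s * c)"
      proof (rule mult_mono)
        show "L s \<le> K s" unfolding K_def using abs_ge_self[of "L s"] norm_ge_zero[of "F s 0"] by linarith
      qed (use E_pos[of s] c K_nonneg[of s] in auto)
      finally show "norm (F s (E s *\<^sub>R z s) - F s (E s *\<^sub>R w s)) \<le> K s * E s * c" by simp
    qed (use KE_int[OF \<open>t \<ge> 0\<close>] in \<open>auto intro!: integrable_diff intg z w integrable_on_mult_left\<close>)
    also have "\<dots> = (E t - 1) / 2 * c"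
      using KE_int[OF \<open>t \<ge> 0\<close>] by (intro integral_unique has_integral_mult_left)
    also have "\<dots> \<le> E t * (c / 2)" using \<open>c \<ge> 0\<close> by (simp add: field_simps)
    finally have "norm (integral {0..t} (\<lambda>s. F s (E s *\<^sub>R z s) - F s (E s *\<^sub>R w s))) \<le> E t * (c / 2)" .
    moreover have "T z t - T w t = (1 / E t) *\<^sub>R integral {0..t} (\<lambda>s. F s (E s *\<^sub>R z s) - F s (E s *\<^sub>R w s))"
      unfolding T_def by (simp add: integral_diff intg z w algebra_simps)
    ultimately show ?thesis using E_pos[of t] by (simp add: field_simps)
  qed
  have T_zero: "norm (T (\<lambda>_. 0) t) \<le> norm x0 + 1" if "t \<ge> 0" for t
  proof -
    have "norm (integral {0..t} (\<lambda>s. F s (E s *\<^sub>R 0))) \<le> integral {0..t} (\<lambda>s. K s * E s)"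
    proof (rule integral_norm_bound_integral)
      fix s
      have "K s * 1 \<le> K s * E s" by (intro mult_left_mono K_nonneg E_ge_1)
      then show "norm (F s (E s *\<^sub>R 0)) \<le> K s * E s" by (simp add: K_def)
    qed (use KE_int[OF that] intg[of "\<lambda>_. 0" t] in auto)
    also have "\<dots> = (E t - 1) / 2" using KE_int[OF that] by (rule integral_unique)
    also have "\<dots> \<le> E t" using E_pos[of t] by simp
    finally have "norm (integral {0..t} (\<lambda>s. F s (E s *\<^sub>R 0))) \<le> E t" .
    moreover have "norm x0 \<le> E t * norm x0" using mult_right_mono[OF E_ge_1, of "norm x0"] by simp
    ultimately have "norm (x0 + integral {0..t} (\<lambda>s. F s (E s *\<^sub>R 0))) \<le> E t * (norm x0 + 1)"
      by (intro norm_triangle_le) (simp add: distrib_left)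
    moreover have "norm (T (\<lambda>_. 0) t) = norm (x0 + integral {0..t} (\<lambda>s. F s (E s *\<^sub>R 0))) / E t"
      unfolding T_def norm_scaleR using E_pos[of t] by simp
    ultimately show ?thesis using E_pos[of t] by (simp add: divide_le_eq mult.commute)
  qed
  have T_cont: "continuous_on {0..} (T z)" if "continuous_on {0..} z" for z
  proof -
    have "continuous_on {0..} (\<lambda>t. integral {0..t} (\<lambda>s. F s (E s *\<^sub>R z s)))"
      by (rule continuous_on_vector_derivative) (use antiderivative_halfline[OF cont_rhs[OF that]] in auto)
    then show ?thesis
      unfolding T_def using E_pos by (intro continuous_intros contE) (auto simp: less_imp_neq[symmetric])
  qed
  have T_bcontfun: "(\<lambda>t. T z (max 0 t)) \<in> bcontfun" if zb: "z \<in> bcontfun" for z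
  proof -
    have z: "continuous_on S z" for S
      using zb by (auto simp: bcontfun_def intro: continuous_on_subset)
    obtain c where c: "\<And>s. norm (z s) \<le> c"
      using zb by (auto simp: bcontfun_def bounded_iff)
    \<comment> \<open>Boundedness comes from comparison with the image of the zero function, using
      the contraction estimate with \<open>w = 0\<close>.\<close>
    have "norm (T z (max 0 t)) \<le> norm x0 + 1 + c / 2" for t
      using T_contr[OF z continuous_on_const, of "max 0 t" 0 c] T_zero[of "max 0 t"] c
        norm_triangle_sub[of "T z (max 0 t)" "T (\<lambda>_. 0) (max 0 t)"] by simp
    moreover have "continuous_on UNIV (\<lambda>t. T z (max 0 t))"
      by (rule continuous_on_compose2[OF T_cont[OF z]]) (auto intro!: continuous_intros)
    ultimately show ?thesis by (auto simp: bcontfun_def bounded_iff)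
  qed
  define \<T> where "\<T> z = Bcontfun (\<lambda>t. T (apply_bcontfun z) (max 0 t))" for z
  have \<T>: "apply_bcontfun (\<T> z) t = T (apply_bcontfun z) (max 0 t)" for z t
    unfolding \<T>_def by (subst Bcontfun_inverse) (auto intro: T_bcontfun apply_bcontfun)
  have "\<exists>!z. \<T> z = z"
  proof (rule banach_fix_type)
    show "\<forall>z w. dist (\<T> z) (\<T> w) \<le> 1 / 2 * dist z w"
    proof (intro allI dist_bound)
      fix z w t
      have "norm (T (apply_bcontfun z) (max 0 t) - T (apply_bcontfun w) (max 0 t)) \<le> dist z w / 2"
        by (rule T_contr) (auto simp flip: dist_norm intro: dist_bounded)
      then show "dist (apply_bcontfun (\<T> z) t) (apply_bcontfun (\<T> w) t) \<le> 1 / 2 * dist z w"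
        by (simp add: \<T> dist_norm)
    qed
  qed auto
  then obtain z where z: "\<T> z = z" by blast
  define x where "x t = E t *\<^sub>R apply_bcontfun z t" for t
  have x_eq: "x t = x0 + integral {0..t} (\<lambda>s. F s (x s))" if "t \<ge> 0" for t
  proof -
    have "apply_bcontfun z t = T (apply_bcontfun z) t" using \<T>[of z t] that by (simp add: z)
    then have "x t = E t *\<^sub>R T (apply_bcontfun z) t" by (simp add: x_def)
    also have "\<dots> = x0 + integral {0..t} (\<lambda>s. F s (x s))"
      using E_pos[of t] by (simp add: T_def x_def)
    finally show ?thesis .
  qed
  have contFx: "continuous_on {0..} (\<lambda>s. F s (x s))"
    unfolding x_def by (rule cont_rhs) simp
  have "(x has_vector_derivative F t (x t)) (at t within {0..})" if "t \<ge> 0" for t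
  proof (rule has_vector_derivative_transform)
    show "((\<lambda>u. x0 + integral {0..u} (\<lambda>s. F s (x s))) has_vector_derivative F t (x t)) (at t within {0..})"
      using has_vector_derivative_add[OF has_vector_derivative_const antiderivative_halfline[OF contFx that], of x0]
      by simp
  qed (use that x_eq in auto)
  then show ?thesis using x_eq[of 0] by (intro exI[of _ x]) simp
qed

lemma global_picard:
  fixes F :: "real \<Rightarrow> 'a::{real_normed_vector, complete_space} \<Rightarrow> 'a"
  assumes contF: "\<And>y. continuous_on {0..} (\<lambda>t. F t y)"
    and contL: "continuous_on {0..} L"
    and lip: "\<And>t y z. t \<ge> 0 \<Longrightarrow> norm (F t y - F t z) \<le> L t * norm (y - z)"
  shows "\<exists>x. x 0 = x0 \<and> (\<forall>t\<ge>0. (x has_vector_derivative F t (x t)) (at t within {0..}))"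
proof -
  define G where "G t y = to_copy (F t (of_copy y))" for t y
  have "continuous_on {0..} (\<lambda>t. G t y)" for y
    unfolding G_def by (intro bounded_linear.continuous_on[OF bounded_linear_to_copy] contF)
  moreover have "norm (G t y - G t z) \<le> L t * norm (y - z)" if "t \<ge> 0" for t y z
    using lip[OF that, of "of_copy y" "of_copy z"]
    by (simp add: G_def norm_banach_copy.rep_eq minus_banach_copy.rep_eq to_copy_inverse)
  ultimately obtain x where x: "x 0 = to_copy x0"
    and deriv: "\<And>t. t \<ge> 0 \<Longrightarrow> (x has_vector_derivative G t (x t)) (at t within {0..})"
    using global_picard_banach[OF _ contL, of G "to_copy x0"] by blast
  have "((\<lambda>s. of_copy (x s)) has_vector_derivative F t (of_copy (x t))) (at t within {0..})"
    if "t \<ge> 0" for t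
    using bounded_linear.has_vector_derivative[OF bounded_linear_of_copy deriv[OF that]]
    by (simp add: G_def to_copy_inverse)
  then show ?thesis
    using x by (intro exI[of _ "\<lambda>t. of_copy (x t)"]) (simp add: to_copy_inverse)
qed

section \<open>The strong Bochner integral\<close>

lemma borel_measurable_AE_limit:
  fixes f :: "'n::euclidean_space \<Rightarrow> real"
  assumes u: "\<And>i. u i \<in> borel_measurable (lebesgue_on S)" and S: "S \<in> sets lebesgue"
    and lim: "AE x in lebesgue_on S. (\<lambda>i. u i x) \<longlonglongrightarrow> f x"
  shows "f \<in> borel_measurable (lebesgue_on S)"
proof -
  have S': "S \<inter> space lebesgue \<in> sets lebesgue" using S by simp
  define v where "v i x = indicator S x *\<^sub>R u i x" for i x
  have "v i \<in> borel_measurable lebesgue" for i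
    using u[of i] unfolding borel_measurable_restrict_space_iff[OF S'] v_def .
  then have "(\<lambda>x. lim (\<lambda>i. v i x)) \<in> borel_measurable lebesgue"
    by (rule borel_measurable_lim_metric)
  \<comment> \<open>On the exceptional null set \<open>f\<close> is arbitrary; completeness of
    Lebesgue measure allows the change there. Extension by zero outside \<open>S\<close> moves the
    argument to the whole space.\<close>
  moreover have "AE x in lebesgue. lim (\<lambda>i. v i x) = indicator S x *\<^sub>R f x"
    using lim unfolding AE_restrict_space_iff[OF S']
  proof eventually_elim
    case (elim x)
    show ?case
    proof (rule limI)
      show "(\<lambda>i. v i x) \<longlonglongrightarrow> indicator S x *\<^sub>R f x"
        using elim by (cases "x \<in> S") (simp_all add: v_def)
    qed
  qed
  ultimately have "(\<lambda>x. indicator S x *\<^sub>R f x) \<in> borel_measurable lebesgue"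
    by (rule borel_measurable_AE)
  then show ?thesis unfolding borel_measurable_restrict_space_iff[OF S'] .
qed

text \<open>No regularity of \<open>h\<close> is required, because \<open>s\<close> takes finitely
  many values on measurable level sets.\<close>

lemma simple_bochner_integrable_borel_measurable:
  "Bochner_Integration.simple_bochner_integrable M s \<Longrightarrow> h \<circ> s \<in> borel_measurable M"
  by (auto elim!: Bochner_Integration.simple_bochner_integrable.cases
      intro!: borel_measurable_simple_function simple_function_compose)

text \<open>The approximating simple functions, composed with the functional given by
  \<open>e\<close>, approximate the scalar integrand; by Cauchy-Schwarz their error is at most
  \<open>norm e\<close> times the original one.\<close>

lemma has_strong_bochner_integral_inner:
  fixes f :: "'n::euclidean_space \<Rightarrow> 'a::real_inner"
  assumes "has_strong_bochner_integral (lebesgue_on S) f I" and S: "S \<in> sets lebesgue"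
  shows "has_bochner_integral (lebesgue_on S) (\<lambda>x. f x \<bullet> e) (I \<bullet> e)"
proof -
  let ?M = "lebesgue_on S"
  obtain s where s: "\<And>i. Bochner_Integration.simple_bochner_integrable ?M (s i)"
    and lim: "AE x in ?M. (\<lambda>i. s i x) \<longlonglongrightarrow> f x"
    and L1: "(\<lambda>i. \<integral>\<^sup>+x. ennreal (norm (f x - s i x)) \<partial>?M) \<longlonglongrightarrow> 0"
    and I: "(\<lambda>i. Bochner_Integration.simple_bochner_integral ?M (s i)) \<longlonglongrightarrow> I"
    using assms(1) unfolding has_strong_bochner_integral_def by blast
  show ?thesis
  proof (rule has_bochner_integral.intros)
    show "(\<lambda>x. f x \<bullet> e) \<in> borel_measurable ?M"
    proof (rule borel_measurable_AE_limit[OF _ S])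
      show "AE x in ?M. (\<lambda>i. s i x \<bullet> e) \<longlonglongrightarrow> f x \<bullet> e"
        using lim by eventually_elim (intro tendsto_intros)
      show "(\<lambda>x. s i x \<bullet> e) \<in> borel_measurable ?M" for i
        using simple_bochner_integrable_borel_measurable[OF s, of "\<lambda>y. y \<bullet> e" i] by (simp add: o_def)
    qed
    show "Bochner_Integration.simple_bochner_integrable ?M (\<lambda>x. s i x \<bullet> e)" for i
      using simple_bochner_integrable_compose2[OF _ s s, of "\<lambda>y _. y \<bullet> e"] by simp
    show "(\<lambda>i. \<integral>\<^sup>+x. ennreal (norm (f x \<bullet> e - s i x \<bullet> e)) \<partial>?M) \<longlonglongrightarrow> 0"
    proof (rule tendsto_sandwich[OF _ _ tendsto_const])
      have "(\<lambda>i. ennreal (norm e) * (\<integral>\<^sup>+x. ennreal (norm (f x - s i x)) \<partial>?M)) \<longlonglongrightarrow> ennreal (norm e) * 0"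
        by (intro ennreal_tendsto_cmult L1) simp
      then show "(\<lambda>i. ennreal (norm e) * (\<integral>\<^sup>+x. ennreal (norm (f x - s i x)) \<partial>?M)) \<longlonglongrightarrow> 0" by simp
      have "(\<integral>\<^sup>+x. ennreal (norm (f x \<bullet> e - s i x \<bullet> e)) \<partial>?M)
          \<le> ennreal (norm e) * (\<integral>\<^sup>+x. ennreal (norm (f x - s i x)) \<partial>?M)" for i
      proof -
        have "(\<integral>\<^sup>+x. ennreal (norm (f x \<bullet> e - s i x \<bullet> e)) \<partial>?M)
            \<le> (\<integral>\<^sup>+x. ennreal (norm e) * ennreal (norm (f x - s i x)) \<partial>?M)"
        proof (rule nn_integral_mono)
          fix x
          have "norm (f x \<bullet> e - s i x \<bullet> e) \<le> norm e * norm (f x - s i x)"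
            using Cauchy_Schwarz_ineq2[of "f x - s i x" e] by (simp add: inner_diff_left mult.commute)
          then show "ennreal (norm (f x \<bullet> e - s i x \<bullet> e)) \<le> ennreal (norm e) * ennreal (norm (f x - s i x))"
            by (simp flip: ennreal_mult)
        qed
        also have "\<dots> = ennreal (norm e) * (\<integral>\<^sup>+x. ennreal (norm (f x - s i x)) \<partial>?M)"
        proof (rule nn_integral_cmult)
          \<comment> \<open>Measurability of this error is not part of the definition; it follows by
            letting \<open>j\<close> tend to infinity in
            \<open>norm (s j x - s i x)\<close>.\<close>
          have "(\<lambda>x. norm (f x - s i x)) \<in> borel_measurable ?M"
          proof (rule borel_measurable_AE_limit[OF _ S])
            show "AE x in ?M. (\<lambda>j. norm (s j x - s i x)) \<longlonglongrightarrow> norm (f x - s i x)"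
              using lim by eventually_elim (intro tendsto_intros)
            show "(\<lambda>x. norm (s j x - s i x)) \<in> borel_measurable ?M" for j
              using simple_bochner_integrable_borel_measurable[OF
                  simple_bochner_integrable_compose2[of "(-)", OF _ s s], of norm j i]
              by (simp add: o_def)
          qed
          then show "(\<lambda>x. ennreal (norm (f x - s i x))) \<in> borel_measurable ?M" by simp
        qed
        finally show ?thesis .
      qed
      then show "\<forall>\<^sub>F i in sequentially. (\<integral>\<^sup>+x. ennreal (norm (f x \<bullet> e - s i x \<bullet> e)) \<partial>?M)
          \<le> ennreal (norm e) * (\<integral>\<^sup>+x. ennreal (norm (f x - s i x)) \<partial>?M)"
        by (intro always_eventually allI)
    qed simp
    have "linear (\<lambda>y. y \<bullet> e)" by (simp add: bounded_linear.linear bounded_linear_inner_left)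
    then have "Bochner_Integration.simple_bochner_integral ?M (\<lambda>x. s i x \<bullet> e)
        = Bochner_Integration.simple_bochner_integral ?M (s i) \<bullet> e" for i
      by (rule simple_bochner_integral_linear[OF _ s])
    then show "(\<lambda>i. Bochner_Integration.simple_bochner_integral ?M (\<lambda>x. s i x \<bullet> e)) \<longlonglongrightarrow> I \<bullet> e"
      using I by (simp add: tendsto_inner)
  qed
qed

text \<open>A single simple function within L1 distance 1 of \<open>f\<close> suffices: the triangle
  inequality bounds the integral of the norm by that distance plus the integral of the simple
  function's norm.\<close>

lemma has_strong_bochner_integral_norm_integrable:
  fixes f :: "'n::euclidean_space \<Rightarrow> 'a::real_normed_vector"
  assumes "has_strong_bochner_integral (lebesgue_on S) f I" and S: "S \<in> sets lebesgue"
  shows "integrable (lebesgue_on S) (\<lambda>x. norm (f x))"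
proof -
  let ?M = "lebesgue_on S"
  obtain s where s: "\<And>i. Bochner_Integration.simple_bochner_integrable ?M (s i)"
    and lim: "AE x in ?M. (\<lambda>i. s i x) \<longlonglongrightarrow> f x"
    and L1: "(\<lambda>i. \<integral>\<^sup>+x. ennreal (norm (f x - s i x)) \<partial>?M) \<longlonglongrightarrow> 0"
    using assms(1) unfolding has_strong_bochner_integral_def by blast
  have "\<forall>\<^sub>F i in sequentially. (\<integral>\<^sup>+x. ennreal (norm (f x - s i x)) \<partial>?M) < 1"
    using L1 by (rule order_tendstoD) simp
  then obtain i where i: "(\<integral>\<^sup>+x. ennreal (norm (f x - s i x)) \<partial>?M) < 1"
    using eventually_happens' sequentially_bot by blast
  have s_meas: "(\<lambda>x. norm (s j x)) \<in> borel_measurable ?M" for j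
    using simple_bochner_integrable_borel_measurable[OF s, of norm j] by (simp add: o_def)
  show ?thesis
  proof (rule integrableI_bounded)
    show "(\<lambda>x. norm (f x)) \<in> borel_measurable ?M"
    proof (rule borel_measurable_AE_limit[OF s_meas S])
      show "AE x in ?M. (\<lambda>i. norm (s i x)) \<longlonglongrightarrow> norm (f x)"
        using lim by eventually_elim (intro tendsto_intros)
    qed
    have "Bochner_Integration.simple_bochner_integrable ?M (\<lambda>x. norm (s i x))"
      using simple_bochner_integrable_compose2[OF _ s s, of "\<lambda>y _. norm y"] by simp
    then have fin: "(\<integral>\<^sup>+x. ennreal (norm (s i x)) \<partial>?M) < \<infinity>"
      using simple_bochner_integral_eq_nn_integral[of ?M "\<lambda>x. norm (s i x)"]
      by (metis ennreal_less_top infinity_ennreal_def norm_ge_zero)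
    have "(\<integral>\<^sup>+x. ennreal (norm (norm (f x))) \<partial>?M)
        \<le> (\<integral>\<^sup>+x. ennreal (norm (f x - s i x)) + ennreal (norm (s i x)) \<partial>?M)"
      by (intro nn_integral_mono)
        (simp add: norm_triangle_sub add.commute flip: ennreal_plus)
    also have "\<dots> = (\<integral>\<^sup>+x. ennreal (norm (f x - s i x)) \<partial>?M) + (\<integral>\<^sup>+x. ennreal (norm (s i x)) \<partial>?M)"
    proof (rule nn_integral_add)
      have "(\<lambda>x. norm (f x - s i x)) \<in> borel_measurable ?M"
      proof (rule borel_measurable_AE_limit[OF _ S])
        show "AE x in ?M. (\<lambda>j. norm (s j x - s i x)) \<longlonglongrightarrow> norm (f x - s i x)"
          using lim by eventually_elim (intro tendsto_intros)
        show "(\<lambda>x. norm (s j x - s i x)) \<in> borel_measurable ?M" for j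
          using simple_bochner_integrable_borel_measurable[OF
              simple_bochner_integrable_compose2[of "(-)", OF _ s s], of norm j i]
          by (simp add: o_def)
      qed
      then show "(\<lambda>x. ennreal (norm (f x - s i x))) \<in> borel_measurable ?M" by simp
      show "(\<lambda>x. ennreal (norm (s i x))) \<in> borel_measurable ?M" using s_meas by simp
    qed
    also have "\<dots> < \<infinity>" using i fin by (simp add: less_top) (metis ennreal_one_less_top less_trans less_top)
    finally show "(\<integral>\<^sup>+x. ennreal (norm (norm (f x))) \<partial>?M) < \<infinity>" .
  qed
qed

text \<open>This is the form in which absolute continuity enters uniqueness. The definition gives
  integrals from 0 only, so the increment over \<open>{u..v}\<close> is tested against itself, the
  vector \<open>e\<close>: additivity is then needed only for real integrals, and dividing by
  \<open>norm e\<close> returns the norm.\<close>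

lemma abs_cont_upto_increment:
  fixes f :: "real \<Rightarrow> 'a::real_inner"
  assumes "abs_cont_upto b f" "b > 0"
  obtains m where "m integrable_on {0..b}"
    and "\<And>u v. 0 \<le> u \<Longrightarrow> u \<le> v \<Longrightarrow> v \<le> b \<Longrightarrow> norm (f v - f u) \<le> integral {u..v} m"
proof -
  obtain g where g: "\<And>t. t \<in> {0..b} \<Longrightarrow> has_strong_bochner_integral (lebesgue_on {0..t}) g (f t - f 0)"
    using assms(1) unfolding abs_cont_upto_def by blast
  define m where "m t = norm (g t)" for t
  have m: "m integrable_on {0..b}"
    using has_strong_bochner_integral_norm_integrable[OF g[of b]] \<open>b > 0\<close>
    unfolding m_def by (intro integrable_on_lebesgue_on) auto
  have m_sub: "m integrable_on {u..v}" if "0 \<le> u" "v \<le> b" for u v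
    using m by (rule integrable_on_subinterval) (use that in auto)
  have "norm (f v - f u) \<le> integral {u..v} m" if uv: "0 \<le> u" "u \<le> v" "v \<le> b" for u v
  proof -
    define e where "e = f v - f u"
    have int: "((\<lambda>s. g s \<bullet> e) has_integral (f t - f 0) \<bullet> e) {0..t}" if "t \<in> {0..b}" for t
      using has_integral_integral_lebesgue_on[of "{0..t}" "\<lambda>s. g s \<bullet> e"]
        has_strong_bochner_integral_inner[OF g[OF that], of e]
      by (auto simp: has_bochner_integral_iff)
    have "integral {0..u} (\<lambda>s. g s \<bullet> e) + integral {u..v} (\<lambda>s. g s \<bullet> e) = integral {0..v} (\<lambda>s. g s \<bullet> e)"
      using int[of v] uv by (intro Henstock_Kurzweil_Integration.integral_combine) (auto simp: has_integral_integrable)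
    then have "integral {u..v} (\<lambda>s. g s \<bullet> e) = e \<bullet> e"
      using int[of u] int[of v] uv by (auto simp: integral_unique e_def inner_diff_left)
    moreover have "integral {u..v} (\<lambda>s. g s \<bullet> e) \<le> integral {u..v} (\<lambda>s. m s * norm e)"
    proof (rule integral_le)
      show "(\<lambda>s. g s \<bullet> e) integrable_on {u..v}"
        by (rule integrable_on_subinterval[OF has_integral_integrable[OF int[of v]]]) (use uv in auto)
      show "(\<lambda>s. m s * norm e) integrable_on {u..v}"
        using uv by (intro integrable_on_mult_left m_sub) auto
    qed (simp add: m_def norm_cauchy_schwarz)
    ultimately have "norm e * norm e \<le> integral {u..v} m * norm e"
      by (simp flip: power2_norm_eq_inner power2_eq_square)
    moreover have "integral {u..v} m \<ge> 0"
      using uv m_sub by (intro Henstock_Kurzweil_Integration.integral_nonneg) (auto simp: m_def)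
    ultimately show ?thesis unfolding e_def[symmetric] by (cases "e = 0") auto
  qed
  then show ?thesis using m that by blast
qed

section \<open>The fundamental theorem of calculus for the strong integral\<close>

lemma simple_bochner_indicator_scaleR:
  fixes y :: "'a::real_normed_vector"
  assumes "A \<in> sets M" "emeasure M A < \<infinity>"
  shows "Bochner_Integration.simple_bochner_integrable M (\<lambda>x. indicator A x *\<^sub>R y)"
    and "Bochner_Integration.simple_bochner_integral M (\<lambda>x. indicator A x *\<^sub>R y) = measure M A *\<^sub>R y"
proof -
  have ind: "Bochner_Integration.simple_bochner_integrable M (indicator A :: _ \<Rightarrow> real)"
    using assms sets.sets_into_space[OF assms(1)]
    by (intro Bochner_Integration.simple_bochner_integrable.intros simple_function_indicator)
      (auto simp: indicator_def Int_absorb1 Collect_conj_eq)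
  show "Bochner_Integration.simple_bochner_integrable M (\<lambda>x. indicator A x *\<^sub>R y)"
    using simple_bochner_integrable_compose2[OF _ ind ind, of "\<lambda>r _. r *\<^sub>R y"] by simp
  have "linear (\<lambda>r. r *\<^sub>R y)" by (simp add: bounded_linear.linear bounded_linear_scaleR_left)
  from simple_bochner_integral_linear[OF this ind]
  show "Bochner_Integration.simple_bochner_integral M (\<lambda>x. indicator A x *\<^sub>R y) = measure M A *\<^sub>R y"
    using simple_bochner_integrable_eq_integral[OF ind] assms
    by (simp add: Int_absorb2 sets.sets_into_space)
qed

text \<open>The proof is by bisection: the property passes to unions of adjacent intervals and holds
  on all short intervals about a point. Half-open supports keep adjacent pieces disjoint, so the
  step functions can be added, and an error proportional to the length is preserved under this
  addition.\<close>

lemma derivative_step_approximation: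
  fixes x :: "real \<Rightarrow> 'a::real_normed_vector"
  assumes "a \<le> b" "\<epsilon> > 0"
    and deriv: "\<And>t. t \<in> {a..b} \<Longrightarrow> (x has_vector_derivative g t) (at t within {a..b})"
    and cont: "continuous_on {a..b} g"
  shows "\<exists>s. Bochner_Integration.simple_bochner_integrable lebesgue s \<and>
    (\<forall>t. t \<notin> {a..<b} \<longrightarrow> s t = 0) \<and> (\<forall>t\<in>{a..<b}. norm (g t - s t) \<le> \<epsilon>) \<and>
    norm (x b - x a - Bochner_Integration.simple_bochner_integral lebesgue s) \<le> \<epsilon> * (b - a)"
proof -
  define Q where "Q c d s \<longleftrightarrow> Bochner_Integration.simple_bochner_integrable lebesgue s \<and>
    (\<forall>t. t \<notin> {c..<d} \<longrightarrow> s t = 0) \<and> (\<forall>t\<in>{c..<d}. norm (g t - s t) \<le> \<epsilon>) \<and>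
    norm (x d - x c - Bochner_Integration.simple_bochner_integral lebesgue s) \<le> \<epsilon> * (d - c)" for c d s
  \<comment> \<open>The range conditions sit inside \<open>P\<close> because the bisection principle
    also asks about short intervals that stick out of \<open>{a..b}\<close>.\<close>
  define P where "P c d \<longleftrightarrow> (a \<le> c \<longrightarrow> c \<le> d \<longrightarrow> d \<le> b \<longrightarrow> (\<exists>s. Q c d s))" for c d
  have "P a b"
  proof (rule Bolzano[OF \<open>a \<le> b\<close>])
    fix c d e assume P: "P c d" "P d e" and cde: "c \<le> d" "d \<le> e"
    show "P c e"
      unfolding P_def
    proof (intro impI)
      assume "a \<le> c" "e \<le> b"
      then obtain s s' where s: "Q c d s" and s': "Q d e s'"
        using P cde unfolding P_def by force
      have "Q c e (\<lambda>t. s t + s' t)"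
        unfolding Q_def
      proof (intro conjI allI ballI impI)
        show "Bochner_Integration.simple_bochner_integrable lebesgue (\<lambda>t. s t + s' t)"
          by (rule simple_bochner_integrable_compose2[of "(+)"]) (use s s' in \<open>auto simp: Q_def\<close>)
        show "s t + s' t = 0" if "t \<notin> {c..<e}" for t
          using s s' cde that by (auto simp: Q_def)
        show "norm (g t - (s t + s' t)) \<le> \<epsilon>" if "t \<in> {c..<e}" for t
          using s s' that by (cases "t < d") (auto simp: Q_def)
        have "Bochner_Integration.simple_bochner_integral lebesgue (\<lambda>t. s t + s' t) =
            Bochner_Integration.simple_bochner_integral lebesgue s
            + Bochner_Integration.simple_bochner_integral lebesgue s'" (is "?I = ?J + ?K")
          using s s' by (intro simple_bochner_integral_add) (auto simp: Q_def)
        then have split: "x e - x c - ?I = (x d - x c - ?J) + (x e - x d - ?K)" by simp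
        have "norm (x d - x c - ?J) \<le> \<epsilon> * (d - c)" "norm (x e - x d - ?K) \<le> \<epsilon> * (e - d)"
          using s s' by (auto simp: Q_def)
        then have "norm (x e - x c - ?I) \<le> \<epsilon> * (d - c) + \<epsilon> * (e - d)"
          unfolding split by (rule norm_triangle_mono)
        then show "norm (x e - x c - ?I) \<le> \<epsilon> * (e - c)" by (simp add: algebra_simps)
      qed
      then show "\<exists>s. Q c e s" by blast
    qed
  next
    fix \<tau> assume \<tau>: "a \<le> \<tau>" "\<tau> \<le> b"
    then obtain \<delta> where "\<delta> > 0" and \<delta>: "\<And>t. t \<in> {a..b} \<Longrightarrow> dist t \<tau> < \<delta> \<Longrightarrow> dist (g t) (g \<tau>) < \<epsilon>"
      using cont \<open>\<epsilon> > 0\<close> unfolding continuous_on_iff by (metis atLeastAtMost_iff)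
    have "P c d" if cd: "c \<le> \<tau>" "\<tau> \<le> d" "d - c < \<delta>" for c d
      unfolding P_def
    proof (intro impI exI)
      assume ab: "a \<le> c" "d \<le> b"
      have near: "norm (g t - g \<tau>) \<le> \<epsilon>" if "t \<in> {c..d}" for t
      proof -
        have "t \<in> {a..b}" "dist t \<tau> < \<delta>" using that cd ab by (auto simp: dist_real_def)
        from \<delta>[OF this] show ?thesis by (simp add: dist_norm)
      qed
      let ?s = "\<lambda>t. indicator {c..<d} t *\<^sub>R g \<tau>"
      show "Q c d ?s"
        unfolding Q_def
      proof (intro conjI allI ballI impI)
        have emeasure: "emeasure lebesgue {c..<d} < \<infinity>" using cd by simp
        show "Bochner_Integration.simple_bochner_integrable lebesgue ?s"
          by (rule simple_bochner_indicator_scaleR[OF _ emeasure]) simp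
        have "Bochner_Integration.simple_bochner_integral lebesgue ?s = (d - c) *\<^sub>R g \<tau>"
          using cd by (subst simple_bochner_indicator_scaleR[OF _ emeasure]) auto
        \<comment> \<open>Mean value inequality for \<open>x\<close> minus its linearisation with
          slope \<open>g \<tau>\<close>, whose derivative \<open>g t - g \<tau>\<close> has norm at
          most \<open>\<epsilon>\<close> on the piece.\<close>
        moreover have "norm (x d - x c - (d - c) *\<^sub>R g \<tau>) \<le> norm (d - c) * \<epsilon>"
        proof (rule vector_differentiable_bound_linearization[of "{c..d}"])
          show "(x has_vector_derivative g t) (at t within {c..d})" if "t \<in> {c..d}" for t
            using that ab by (intro has_vector_derivative_within_subset[OF deriv]) auto
        qed (use near cd in \<open>auto simp: closed_segment_eq_real_ivl\<close>)
        ultimately show "norm (x d - x c - Bochner_Integration.simple_bochner_integral lebesgue ?s) \<le> \<epsilon> * (d - c)"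
          using cd by (simp add: mult.commute)
      qed (use near in auto)
    qed
    then show "\<exists>\<delta>>0. \<forall>c d. c \<le> \<tau> \<and> \<tau> \<le> d \<and> d - c < \<delta> \<longrightarrow> P c d"
      using \<open>\<delta> > 0\<close> by blast
  qed
  then show ?thesis using \<open>a \<le> b\<close> by (simp add: P_def Q_def)
qed

lemma has_strong_bochner_integral_derivative:
  fixes x :: "real \<Rightarrow> 'a::real_normed_vector"
  assumes "a \<le> b"
    and deriv: "\<And>t. t \<in> {a..b} \<Longrightarrow> (x has_vector_derivative g t) (at t within {a..b})"
    and cont: "continuous_on {a..b} g"
  shows "has_strong_bochner_integral (lebesgue_on {a..b}) g (x b - x a)"
proof -
  let ?M = "lebesgue_on {a..b}"
  define Q where "Q \<epsilon> s \<longleftrightarrow> Bochner_Integration.simple_bochner_integrable lebesgue s \<and>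
    (\<forall>t. t \<notin> {a..<b} \<longrightarrow> s t = 0) \<and> (\<forall>t\<in>{a..<b}. norm (g t - s t) \<le> \<epsilon>) \<and>
    norm (x b - x a - Bochner_Integration.simple_bochner_integral lebesgue s) \<le> \<epsilon> * (b - a)" for \<epsilon> s
  define \<epsilon> where "\<epsilon> n = inverse (real (Suc n))" for n
  have \<epsilon>_pos: "\<epsilon> n > 0" for n by (simp add: \<epsilon>_def)
  have \<epsilon>_lim: "\<epsilon> \<longlonglongrightarrow> 0" unfolding \<epsilon>_def by (rule LIMSEQ_inverse_real_of_nat)
  have "\<exists>s. Q (\<epsilon> n) s" for n
    unfolding Q_def using derivative_step_approximation[OF \<open>a \<le> b\<close> \<epsilon>_pos deriv cont] .
  then obtain s where Q: "\<And>n. Q (\<epsilon> n) (s n)" by metis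
  have s_ind: "(\<lambda>t. indicator {a..b} t *\<^sub>R s n t) = s n" for n
    using Q[of n] by (auto simp: Q_def fun_eq_iff indicator_def)
  have s: "Bochner_Integration.simple_bochner_integrable ?M (s n)" for n
    using Q[of n] by (subst simple_bochner_integrable_restrict_space) (simp_all add: s_ind Q_def)
  have s_int: "Bochner_Integration.simple_bochner_integral ?M (s n)
      = Bochner_Integration.simple_bochner_integral lebesgue (s n)" for n
    using s[of n] by (subst simple_bochner_integral_restrict_space) (simp_all add: s_ind)
  have near: "norm (g t - s n t) \<le> \<epsilon> n" if "t \<in> {a..<b}" for t n
    using Q[of n] that by (simp add: Q_def)
  \<comment> \<open>The step functions vanish at the right endpoint, so they converge to
    \<open>g\<close> only away from the null set \<open>{b}\<close>.\<close>
  have "AE t in lebesgue. t \<noteq> b"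
    by (rule AE_I'[of "{b}"]) (auto simp: null_sets_completionI)
  then have AE: "AE t in ?M. t \<in> {a..<b}"
    by (subst AE_restrict_space_iff) auto
  show ?thesis
    unfolding has_strong_bochner_integral_def
  proof (intro exI[of _ s] conjI allI s)
    show "AE t in ?M. (\<lambda>n. s n t) \<longlonglongrightarrow> g t"
      using AE
    proof eventually_elim
      case (elim t)
      have "(\<lambda>n. g t - s n t) \<longlonglongrightarrow> 0"
        by (rule Lim_null_comparison[OF _ \<epsilon>_lim]) (use near[OF elim] in auto)
      from tendsto_diff[OF tendsto_const[of "g t"] this] show ?case by simp
    qed
    show "(\<lambda>n. \<integral>\<^sup>+t. ennreal (norm (g t - s n t)) \<partial>?M) \<longlonglongrightarrow> 0"
    proof (rule tendsto_sandwich[OF _ _ tendsto_const])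
      have "(\<lambda>n. \<epsilon> n * (b - a)) \<longlonglongrightarrow> 0" using tendsto_mult_right[OF \<epsilon>_lim, of "b - a"] by simp
      then show "(\<lambda>n. ennreal (\<epsilon> n * (b - a))) \<longlonglongrightarrow> 0"
        using tendsto_ennrealI by fastforce
      have "(\<integral>\<^sup>+t. ennreal (norm (g t - s n t)) \<partial>?M) \<le> ennreal (\<epsilon> n * (b - a))" for n
      proof -
        have "(\<integral>\<^sup>+t. ennreal (norm (g t - s n t)) \<partial>?M) \<le> (\<integral>\<^sup>+t. ennreal (\<epsilon> n) \<partial>?M)"
          using AE by (intro nn_integral_mono_AE, eventually_elim) (use near in \<open>auto intro: ennreal_leI\<close>)
        also have "\<dots> = ennreal (\<epsilon> n * (b - a))"
          using \<open>a \<le> b\<close> \<epsilon>_pos[of n] by (simp add: emeasure_restrict_space ennreal_mult)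
        finally show ?thesis .
      qed
      then show "\<forall>\<^sub>F n in sequentially. (\<integral>\<^sup>+t. ennreal (norm (g t - s n t)) \<partial>?M) \<le> ennreal (\<epsilon> n * (b - a))"
        by (intro always_eventually allI)
    qed simp
    have "(\<lambda>n. x b - x a - Bochner_Integration.simple_bochner_integral ?M (s n)) \<longlonglongrightarrow> 0"
    proof (rule Lim_null_comparison)
      show "(\<lambda>n. \<epsilon> n * (b - a)) \<longlonglongrightarrow> 0" using tendsto_mult_right[OF \<epsilon>_lim, of "b - a"] by simp
    qed (use Q in \<open>auto simp: Q_def s_int\<close>)
    from tendsto_diff[OF tendsto_const[of "x b - x a"] this]
    show "(\<lambda>n. Bochner_Integration.simple_bochner_integral ?M (s n)) \<longlonglongrightarrow> x b - x a" by simp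
  qed
qed

section \<open>Uniqueness of absolutely continuous solutions\<close>

text \<open>
  Tags in the exceptional set \<open>N\<close> are controlled by Henstock's lemma for the function that equals
  \<open>m\<close> off \<open>N\<close> and \<open>0\<close> on \<open>N\<close>, which replaces the usual Vitali covering argument.
\<close>

lemma nonincreasing_if_AE_derivative_nonpos:
  fixes \<phi> m :: "real \<Rightarrow> real"
  assumes "a \<le> b" and m: "m integrable_on {a..b}"
    and incr: "\<And>u v. a \<le> u \<Longrightarrow> u \<le> v \<Longrightarrow> v \<le> b \<Longrightarrow> \<phi> v - \<phi> u \<le> integral {u..v} m"
    and N: "negligible N"
    and deriv: "\<And>t. t \<in> {a..b} - N \<Longrightarrow> \<exists>d\<le>0. (\<phi> has_real_derivative d) (at t within {a..b})"
  shows "\<phi> b \<le> \<phi> a"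
proof -
  define m' where "m' t = (if t \<in> N then 0 else m t)" for t
  have m': "m' integrable_on {a..b}"
    by (rule integrable_spike[OF m N]) (simp add: m'_def)
  have m'_eq: "integral {u..v} m' = integral {u..v} m" for u v
    by (rule integral_spike[OF N]) (simp add: m'_def)
  have bound: "\<phi> b - \<phi> a \<le> \<epsilon> * (b - a) + \<epsilon>" if "\<epsilon> > 0" for \<epsilon>
  proof -
    obtain \<gamma> where "gauge \<gamma>"
      and \<gamma>: "\<And>p. p tagged_partial_division_of cbox a b \<Longrightarrow> \<gamma> fine p \<Longrightarrow>
        (\<Sum>(t, K)\<in>p. norm (Henstock_Kurzweil_Integration.content K *\<^sub>R m' t - integral K m')) < \<epsilon>"
      using Henstock_lemma[of m' a b \<epsilon>] m' \<open>\<epsilon> > 0\<close> by (auto simp: box_real)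
    \<comment> \<open>Straddle estimate: as \<open>t\<close> lies between \<open>u\<close> and
      \<open>v\<close>, both linear terms have the sign of \<open>d\<close>, and the two errors add
      up to \<open>\<epsilon> * (v - u)\<close>.\<close>
    have "\<exists>\<delta>>0. \<forall>u\<in>{a..b}. \<forall>v\<in>{a..b}. u \<le> t \<longrightarrow> t \<le> v \<longrightarrow> \<bar>u - t\<bar> < \<delta> \<longrightarrow> \<bar>v - t\<bar> < \<delta> \<longrightarrow>
        \<phi> v - \<phi> u \<le> \<epsilon> * (v - u)" if t: "t \<in> {a..b} - N" for t
    proof -
      obtain d where "d \<le> 0" and d: "(\<phi> has_derivative (*) d) (at t within {a..b})"
        using deriv[OF t] by (auto simp: has_field_derivative_def)
      then obtain \<delta> where "\<delta> > 0"
        and \<delta>: "\<And>y. y \<in> {a..b} \<Longrightarrow> \<bar>y - t\<bar> < \<delta> \<Longrightarrow> \<bar>\<phi> y - \<phi> t - d * (y - t)\<bar> \<le> \<epsilon> * \<bar>y - t\<bar>"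
        using \<open>\<epsilon> > 0\<close> unfolding has_derivative_within_alt by fastforce
      have "\<phi> v - \<phi> u \<le> \<epsilon> * (v - u)"
        if uv: "u \<in> {a..b}" "v \<in> {a..b}" "u \<le> t" "t \<le> v" "\<bar>u - t\<bar> < \<delta>" "\<bar>v - t\<bar> < \<delta>" for u v
      proof -
        have "\<phi> v - \<phi> t - d * (v - t) \<le> \<epsilon> * (v - t)" "\<phi> t - \<phi> u - d * (t - u) \<le> \<epsilon> * (t - u)"
          using \<delta>[of u] \<delta>[of v] uv by (auto simp: abs_le_iff algebra_simps)
        moreover have "d * (v - t) \<le> 0" "d * (t - u) \<le> 0"
          using \<open>d \<le> 0\<close> uv by (auto simp: mult_nonpos_nonneg)
        moreover have "\<epsilon> * (v - u) = \<epsilon> * (v - t) + \<epsilon> * (t - u)" by (simp add: algebra_simps)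
        ultimately show ?thesis by linarith
      qed
      then show ?thesis using \<open>\<delta> > 0\<close> by blast
    qed
    then obtain \<delta> where \<delta>_pos: "\<And>t. t \<in> {a..b} - N \<Longrightarrow> \<delta> t > 0"
      and \<delta>: "\<And>t u v. t \<in> {a..b} - N \<Longrightarrow> u \<in> {a..b} \<Longrightarrow> v \<in> {a..b} \<Longrightarrow> u \<le> t \<Longrightarrow> t \<le> v \<Longrightarrow>
        \<bar>u - t\<bar> < \<delta> t \<Longrightarrow> \<bar>v - t\<bar> < \<delta> t \<Longrightarrow> \<phi> v - \<phi> u \<le> \<epsilon> * (v - u)"
      by metis
    define \<gamma>' where "\<gamma>' t = (if t \<in> {a..b} - N then ball t (\<delta> t) else ball t 1)" for t
    have "gauge \<gamma>'" using \<delta>_pos by (auto simp: gauge_def \<gamma>'_def)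
    then obtain p where p: "p tagged_division_of {a..b}" and fine: "(\<lambda>t. \<gamma> t \<inter> \<gamma>' t) fine p"
      using fine_division_exists_real[OF gauge_Int[OF \<open>gauge \<gamma>\<close>]] by blast
    have fines: "\<gamma> fine p" "\<gamma>' fine p" using fine by (auto simp: fine_Int)
    \<comment> \<open>Off \<open>N\<close> the straddle estimate yields the first summand; on
      \<open>N\<close> the increment bound yields the second, since \<open>m'\<close> vanishes at
      the tag. A common bound for all tagged intervals lets the increments telescope while the two
      kinds of error are summed separately.\<close>
    have step: "\<phi> (Sup K) - \<phi> (Inf K) \<le> \<epsilon> * Henstock_Kurzweil_Integration.content K + norm (Henstock_Kurzweil_Integration.content K *\<^sub>R m' t - integral K m')"
      if tK: "(t, K) \<in> p" for t K
    proof -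
      obtain u v where K: "K = {u..v}" using tagged_division_ofD(4)[OF p tK] by (auto simp: box_real)
      have t: "t \<in> K" and sub: "K \<subseteq> {a..b}" using tagged_division_ofD(2,3)[OF p tK] by auto
      have uv: "u \<le> v" "u \<le> t" "t \<le> v" "a \<le> u" "v \<le> b" using t sub K by auto
      show ?thesis
      proof (cases "t \<in> N")
        case True
        have "\<phi> v - \<phi> u \<le> integral K m'" using incr uv by (simp add: K m'_eq)
        also have "\<dots> \<le> norm (Henstock_Kurzweil_Integration.content K *\<^sub>R m' t - integral K m')" using True by (simp add: m'_def)
        finally have "\<phi> v - \<phi> u \<le> norm (Henstock_Kurzweil_Integration.content K *\<^sub>R m' t - integral K m')" .
        moreover have "0 \<le> \<epsilon> * Henstock_Kurzweil_Integration.content K" using \<open>\<epsilon> > 0\<close> by simp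
        ultimately show ?thesis using uv by (simp add: K)
      next
        case False
        have "K \<subseteq> ball t (\<delta> t)"
          using fineD[OF fines(2) tK] False uv by (auto simp: \<gamma>'_def)
        moreover have "u \<in> K" "v \<in> K" using uv by (auto simp: K)
        ultimately have "\<bar>u - t\<bar> < \<delta> t" "\<bar>v - t\<bar> < \<delta> t"
          by (auto simp: dist_real_def abs_minus_commute dest: subsetD)
        then have "\<phi> v - \<phi> u \<le> \<epsilon> * (v - u)"
          using False uv by (intro \<delta>[of t]) auto
        then show ?thesis using uv by (simp add: K add_increasing2)
      qed
    qed
    have "\<phi> b - \<phi> a = (\<Sum>(t, K)\<in>p. \<phi> (Sup K) - \<phi> (Inf K))"
      by (rule additive_tagged_division_1[OF \<open>a \<le> b\<close> p, symmetric])
    also have "\<dots> \<le> (\<Sum>(t, K)\<in>p. \<epsilon> * Henstock_Kurzweil_Integration.content K + norm (Henstock_Kurzweil_Integration.content K *\<^sub>R m' t - integral K m'))"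
      using step by (intro sum_mono) auto
    also have "\<dots> = \<epsilon> * (\<Sum>(t, K)\<in>p. Henstock_Kurzweil_Integration.content K) + (\<Sum>(t, K)\<in>p. norm (Henstock_Kurzweil_Integration.content K *\<^sub>R m' t - integral K m'))"
      by (simp add: sum.distrib sum_distrib_left case_prod_beta)
    also have "(\<Sum>(t, K)\<in>p. Henstock_Kurzweil_Integration.content K) = b - a"
      using additive_content_tagged_division[of p a b] p \<open>a \<le> b\<close> by (simp add: box_real)
    also have "(\<Sum>(t, K)\<in>p. norm (Henstock_Kurzweil_Integration.content K *\<^sub>R m' t - integral K m')) \<le> \<epsilon>"
      using \<gamma>[OF _ fines(1)] p by (simp add: box_real tagged_division_of_def less_imp_le)
    finally show ?thesis by simp
  qed
  have "((\<lambda>\<epsilon>. \<epsilon> * (b - a) + \<epsilon>) \<longlongrightarrow> 0 * (b - a) + 0) (at_right 0)"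
    by (intro tendsto_intros)
  moreover have "\<forall>\<^sub>F \<epsilon> in at_right 0. \<phi> b - \<phi> a \<le> \<epsilon> * (b - a) + \<epsilon>"
    unfolding eventually_at_right_field by (rule exI[of _ 1]) (use bound in auto)
  ultimately have "\<phi> b - \<phi> a \<le> 0 * (b - a) + 0"
    by (rule tendsto_lowerbound) simp
  then show ?thesis by simp
qed

text \<open>The norm may fail to be differentiable where the solutions meet, so its square is used.
  The derivative of the square is twice the inner product of \<open>w t\<close> with
  \<open>p - q\<close>, hence at most \<open>2 * M\<close> times the square, which is the decay rate
  of the weight.\<close>

lemma uniqueness_AE_gronwall:
  fixes x y :: "real \<Rightarrow> 'a::real_inner"
  assumes "T > 0" "x 0 = y 0"
    and m1: "m1 integrable_on {0..T}"
    and x: "\<And>u v. 0 \<le> u \<Longrightarrow> u \<le> v \<Longrightarrow> v \<le> T \<Longrightarrow> norm (x v - x u) \<le> integral {u..v} m1"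
    and m2: "m2 integrable_on {0..T}"
    and y: "\<And>u v. 0 \<le> u \<Longrightarrow> u \<le> v \<Longrightarrow> v \<le> T \<Longrightarrow> norm (y v - y u) \<le> integral {u..v} m2"
    and N: "negligible N" and "M \<ge> 0"
    and deriv: "\<And>t. t \<in> {0..T} - N \<Longrightarrow> \<exists>p q. (x has_vector_derivative p) (at t within {0..T}) \<and>
      (y has_vector_derivative q) (at t within {0..T}) \<and> norm (p - q) \<le> M * norm (x t - y t)"
  shows "x T = y T"
proof -
  define w where "w t = x t - y t" for t
  define m where "m t = m1 t + m2 t" for t
  have m_int: "m integrable_on {0..T}" unfolding m_def using m1 m2 by (rule integrable_add)
  have m: "m integrable_on {u..v}" if "0 \<le> u" "v \<le> T" for u v
    using m_int by (rule integrable_on_subinterval) (use that in auto)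
  have w_incr: "norm (w v - w u) \<le> integral {u..v} m" if uv: "0 \<le> u" "u \<le> v" "v \<le> T" for u v
  proof -
    have "m1 integrable_on {u..v}" "m2 integrable_on {u..v}"
      using uv by (auto intro: integrable_on_subinterval[OF m1] integrable_on_subinterval[OF m2])
    then have "integral {u..v} m = integral {u..v} m1 + integral {u..v} m2"
      unfolding m_def by (rule Henstock_Kurzweil_Integration.integral_add)
    moreover have "norm (w v - w u) \<le> norm (x v - x u) + norm (y v - y u)"
      using norm_triangle_ineq4[of "x v - x u" "y v - y u"] by (simp add: w_def algebra_simps)
    ultimately show ?thesis using x[OF uv] y[OF uv] by linarith
  qed
  \<comment> \<open>A uniform bound for \<open>norm (w t)\<close>, needed to pass from increments of
    \<open>w\<close> to increments of its square.\<close>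
  define K where "K = integral {0..T} m"
  have w_bound: "norm (w t) \<le> K" if t: "0 \<le> t" "t \<le> T" for t
  proof -
    have "norm (w t) \<le> integral {0..t} m" using w_incr[of 0 t] t \<open>x 0 = y 0\<close> by (simp add: w_def)
    moreover have "0 \<le> integral {t..T} m" using w_incr[of t T] t norm_ge_zero order_trans by blast
    moreover have "integral {0..t} m + integral {t..T} m = K"
      unfolding K_def using t m_int by (rule Henstock_Kurzweil_Integration.integral_combine)
    ultimately show ?thesis by linarith
  qed
  define \<phi> where "\<phi> t = exp (- 2 * M * t) * (w t \<bullet> w t)" for t
  have "\<phi> T \<le> \<phi> 0"
  proof (rule nonincreasing_if_AE_derivative_nonpos[where a = 0 and b = T and \<phi> = \<phi> and m = "\<lambda>s. 2 * K * m s" and N = N])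
    show "negligible N" by (rule N)
    show "(\<lambda>s. 2 * K * m s) integrable_on {0..T}" using m_int by (rule integrable_on_mult_right)
    show "\<phi> v - \<phi> u \<le> integral {u..v} (\<lambda>s. 2 * K * m s)" if uv: "0 \<le> u" "u \<le> v" "v \<le> T" for u v
    proof -
      \<comment> \<open>The weight decreases, so its value at \<open>v\<close> may be replaced by
        the one at \<open>u\<close>, which is at most 1. The difference of squares is a sum of
        norms, at most \<open>2 * K\<close>, times a difference of norms.\<close>
      have "exp (- 2 * M * v) \<le> exp (- 2 * M * u)" using uv \<open>M \<ge> 0\<close> by (simp add: mult_left_mono)
      then have "\<phi> v \<le> exp (- 2 * M * u) * (w v \<bullet> w v)" unfolding \<phi>_def by (rule mult_right_mono) simp
      then have "\<phi> v - \<phi> u \<le> exp (- 2 * M * u) * ((norm (w v))\<^sup>2 - (norm (w u))\<^sup>2)"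
        by (simp add: \<phi>_def power2_norm_eq_inner right_diff_distrib)
      also have "\<dots> \<le> exp (- 2 * M * u) * (2 * K * integral {u..v} m)"
      proof (rule mult_left_mono)
        have "(norm (w v))\<^sup>2 - (norm (w u))\<^sup>2 = (norm (w v) + norm (w u)) * (norm (w v) - norm (w u))"
          by (simp add: power2_eq_square algebra_simps)
        also have "\<dots> \<le> (norm (w v) + norm (w u)) * integral {u..v} m"
          using w_incr[OF uv] norm_triangle_ineq2[of "w v" "w u"] by (intro mult_left_mono) auto
        also have "\<dots> \<le> 2 * K * integral {u..v} m"
          using w_incr[OF uv] w_bound[of u] w_bound[of v] uv order_trans[OF norm_ge_zero w_incr[OF uv]]
          by (intro mult_right_mono) auto
        finally show "(norm (w v))\<^sup>2 - (norm (w u))\<^sup>2 \<le> 2 * K * integral {u..v} m" .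
      qed simp
      also have "\<dots> \<le> 1 * (2 * K * integral {u..v} m)"
      proof (rule mult_right_mono)
        have "K \<ge> 0" using w_bound[of 0] \<open>T > 0\<close> norm_ge_zero[of "w 0"] by linarith
        then show "0 \<le> 2 * K * integral {u..v} m"
          using order_trans[OF norm_ge_zero w_incr[OF uv]] by simp
      qed (use uv \<open>M \<ge> 0\<close> in simp)
      finally show ?thesis by simp
    qed
    show "\<exists>d\<le>0. (\<phi> has_real_derivative d) (at t within {0..T})" if t: "t \<in> {0..T} - N" for t
    proof -
      obtain p q where x': "(x has_vector_derivative p) (at t within {0..T})"
        and y': "(y has_vector_derivative q) (at t within {0..T})"
        and pq: "norm (p - q) \<le> M * norm (x t - y t)"
        using deriv[OF t] by blast
      have w': "(w has_vector_derivative (p - q)) (at t within {0..T})"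
        unfolding w_def by (rule has_vector_derivative_diff[OF x' y'])
      have "((\<lambda>s. w s \<bullet> w s) has_real_derivative (w t \<bullet> (p - q) + (p - q) \<bullet> w t)) (at t within {0..T})"
        unfolding has_real_derivative_iff_has_vector_derivative
        by (rule bounded_bilinear.has_vector_derivative[OF bounded_bilinear_inner w' w'])
      then have "(\<phi> has_real_derivative
          (exp (- 2 * M * t) * (w t \<bullet> (p - q) + (p - q) \<bullet> w t) + exp (- 2 * M * t) * (- 2 * M) * (w t \<bullet> w t)))
          (at t within {0..T})"
        unfolding \<phi>_def by (auto intro!: derivative_eq_intros)
      moreover have "exp (- 2 * M * t) * (w t \<bullet> (p - q) + (p - q) \<bullet> w t) + exp (- 2 * M * t) * (- 2 * M) * (w t \<bullet> w t)
          = 2 * exp (- 2 * M * t) * (w t \<bullet> (p - q) - M * (w t \<bullet> w t))"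
        by (simp add: inner_commute algebra_simps)
      moreover have "w t \<bullet> (p - q) \<le> M * (w t \<bullet> w t)"
      proof -
        have "w t \<bullet> (p - q) \<le> norm (w t) * norm (p - q)" by (rule norm_cauchy_schwarz)
        also have "\<dots> \<le> norm (w t) * (M * norm (w t))" using pq by (intro mult_left_mono) (auto simp: w_def)
        also have "\<dots> = M * (w t \<bullet> w t)"
          by (simp add: power2_eq_square flip: power2_norm_eq_inner)
        finally show ?thesis .
      qed
      ultimately show ?thesis by (metis (no_types, lifting) diff_le_0_iff_le exp_ge_zero
            mult_nonneg_nonpos zero_le_mult_iff zero_le_numeral)
    qed
  qed (use \<open>T > 0\<close> in auto)
  then have "w T \<bullet> w T \<le> 0"
    using \<open>x 0 = y 0\<close> by (simp add: \<phi>_def w_def mult_le_0_iff)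
  then have "w T \<bullet> w T = 0" by (intro order_antisym inner_ge_zero)
  then show ?thesis by (simp add: w_def)
qed

section \<open>Passing between the half-line and bounded intervals\<close>

lemma AE_halfline_negligible:
  assumes "AE t in lebesgue_on {0::real..}. P t"
  obtains N where "negligible N" "\<And>t. t \<ge> 0 \<Longrightarrow> t \<notin> N \<Longrightarrow> P t"
proof -
  have "AE t in lebesgue. t \<in> {0..} \<longrightarrow> P t"
    using assms by (subst (asm) AE_restrict_space_iff) auto
  then obtain N where "negligible N" "{t. \<not> (t \<in> {0..} \<longrightarrow> P t)} \<subseteq> N"
    unfolding eventually_ae_filter_negligible by blast
  then show ?thesis by (intro that[of N]) auto
qed

lemma continuous_on_halflineI:
  fixes f :: "real \<Rightarrow> 'b::topological_space"
  assumes "\<And>b. b > 0 \<Longrightarrow> continuous_on {0..b} f"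
  shows "continuous_on {0..} f"
  unfolding continuous_on_def
proof
  fix t :: real assume "t \<in> {0..}"
  then have "(f \<longlongrightarrow> f t) (at t within {0..t + 1})"
    using assms[of "t + 1"] by (auto simp: continuous_on_def)
  also have "at t within {0..t + 1} = at t within {0..}"
    using \<open>t \<in> {0..}\<close> by (intro at_within_nhd[of _ "{t - 1<..<t + 1}"]) auto
  finally show "(f \<longlongrightarrow> f t) (at t within {0..})" .
qed

lemma abs_cont_upto_solution:
  fixes x :: "real \<Rightarrow> 'a::real_normed_vector"
  assumes deriv: "\<And>t. t \<ge> 0 \<Longrightarrow> (x has_vector_derivative g t) (at t within {0..})"
    and cont: "continuous_on {0..} g"
  shows "abs_cont_upto b x"
  unfolding abs_cont_upto_def
proof (intro exI[of _ g] ballI has_strong_bochner_integral_derivative)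
  fix t \<tau> :: real assume "\<tau> \<in> {0..t}"
  then show "(x has_vector_derivative g \<tau>) (at \<tau> within {0..t})"
    by (intro has_vector_derivative_within_subset[OF deriv]) auto
qed (auto intro: continuous_on_subset[OF cont])

lemma strong_global_solution_unique:
  fixes x y :: "real \<Rightarrow> 'a::real_inner" and F :: "real \<Rightarrow> 'a \<Rightarrow> 'a"
  assumes x: "\<And>b. b > 0 \<Longrightarrow> abs_cont_upto b x"
    "AE t in lebesgue_on {0..}. (x has_vector_derivative F t (x t)) (at t within {0..})"
    and y: "\<And>b. b > 0 \<Longrightarrow> abs_cont_upto b y"
    "AE t in lebesgue_on {0..}. (y has_vector_derivative F t (y t)) (at t within {0..})"
    and "x 0 = y 0"
    and contL: "continuous_on {0..} L"
    and lip: "\<And>t y z. t \<ge> 0 \<Longrightarrow> norm (F t y - F t z) \<le> L t * norm (y - z)"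
    and "T \<ge> 0"
  shows "x T = y T"
proof (cases "T = 0")
  case False
  then have "T > 0" using \<open>T \<ge> 0\<close> by simp
  obtain m1 where m1: "m1 integrable_on {0..T}"
    "\<And>u v. 0 \<le> u \<Longrightarrow> u \<le> v \<Longrightarrow> v \<le> T \<Longrightarrow> norm (x v - x u) \<le> integral {u..v} m1"
    using abs_cont_upto_increment[OF x(1)] \<open>T > 0\<close> by blast
  obtain m2 where m2: "m2 integrable_on {0..T}"
    "\<And>u v. 0 \<le> u \<Longrightarrow> u \<le> v \<Longrightarrow> v \<le> T \<Longrightarrow> norm (y v - y u) \<le> integral {u..v} m2"
    using abs_cont_upto_increment[OF y(1)] \<open>T > 0\<close> by blast
  obtain N1 where N1: "negligible N1"
    "\<And>t. t \<ge> 0 \<Longrightarrow> t \<notin> N1 \<Longrightarrow> (x has_vector_derivative F t (x t)) (at t within {0..})"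
    using AE_halfline_negligible[OF x(2)] by blast
  obtain N2 where N2: "negligible N2"
    "\<And>t. t \<ge> 0 \<Longrightarrow> t \<notin> N2 \<Longrightarrow> (y has_vector_derivative F t (y t)) (at t within {0..})"
    using AE_halfline_negligible[OF y(2)] by blast
  \<comment> \<open>Each \<open>T\<close> is treated separately, so compactness turns the
    time-dependent Lipschitz bound into a constant.\<close>
  have "compact (L ` {0..T})"
    by (intro compact_continuous_image continuous_on_subset[OF contL]) auto
  then have "bounded (L ` {0..T})" by (rule compact_imp_bounded)
  then obtain M where M: "\<And>t. t \<in> {0..T} \<Longrightarrow> \<bar>L t\<bar> \<le> M"
    unfolding bounded_iff by force
  show ?thesis
  proof (rule uniqueness_AE_gronwall[OF \<open>T > 0\<close> \<open>x 0 = y 0\<close> m1 m2])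
    show "negligible (N1 \<union> N2)" using N1 N2 by (intro negligible_Un)
    show "M \<ge> 0" using M[of 0] \<open>T > 0\<close> abs_ge_zero[of "L 0"] by simp
    show "\<exists>p q. (x has_vector_derivative p) (at t within {0..T}) \<and>
        (y has_vector_derivative q) (at t within {0..T}) \<and> norm (p - q) \<le> M * norm (x t - y t)"
      if t: "t \<in> {0..T} - (N1 \<union> N2)" for t
    proof (intro exI conjI)
      show "(x has_vector_derivative F t (x t)) (at t within {0..T})"
        by (rule has_vector_derivative_within_subset[OF N1(2)]) (use t in auto)
      show "(y has_vector_derivative F t (y t)) (at t within {0..T})"
        by (rule has_vector_derivative_within_subset[OF N2(2)]) (use t in auto)
      have "norm (F t (x t) - F t (y t)) \<le> L t * norm (x t - y t)" using lip t by simp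
      also have "\<dots> \<le> M * norm (x t - y t)"
        using M[of t] t by (intro mult_right_mono) auto
      finally show "norm (F t (x t) - F t (y t)) \<le> M * norm (x t - y t)" .
    qed
  qed
qed (use \<open>x 0 = y 0\<close> in simp)

section \<open>The dynamical system\<close>

theorem mainTheorem2:
  fixes A :: "'a::{real_inner, complete_space} \<Rightarrow> 'a set"
    and D B :: "'a \<Rightarrow> 'a"
    and \<eta> \<mu> :: real
    and lam \<beta> :: "real \<Rightarrow> real"
  assumes "maximally_monotone A"
    and "\<eta> > 0" and "cocoercive \<eta> D"
    and "\<mu> > 0" and "cocoercive \<mu> B"
    and "zer (\<lambda>x. {B x}) \<noteq> {}"
    and "\<And>t. t \<ge> 0 \<Longrightarrow> lam t > 0" and "\<And>t. t \<ge> 0 \<Longrightarrow> \<beta> t > 0"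
    and "\<And>b. b > 0 \<Longrightarrow> continuous_on {0..b} lam"
    and "\<And>b. b > 0 \<Longrightarrow> continuous_on {0..b} \<beta>"
  shows "\<forall>x0. \<exists>x. strong_global_solution A D B lam \<beta> x0 x \<and>
           (\<forall>y. strong_global_solution A D B lam \<beta> x0 y \<longrightarrow> (\<forall>t\<ge>0. y t = x t))"
proof -
  \<comment> \<open>A total function for convenience; it is meaningful for \<open>c > 0\<close>, the
    only case in which it is evaluated as a resolvent below.\<close>
  define J where "J c z = (THE p. p \<in> resolvent (scale_op c A) z)" for c z
  have J: "resolvent (scale_op c A) z = {J c z}" if "c > 0" for c z
    using resolvent_singleton[OF assms(1) that, of z] by (auto simp: J_def)
  have J_graph: "\<exists>u. u \<in> A (J c z) \<and> z = J c z + c *\<^sub>R u" if "c > 0" for c z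
    using J[OF that, of z] resolvent_scale_op_iff[of "J c z" c A z] by simp
  have mono: "monotone_op A" using assms(1) by (simp add: maximally_monotone_def)
  have J_nonexp: "norm (J c z - J c z') \<le> norm (z - z')" if c: "c > 0" for c z z'
  proof -
    obtain u v where "u \<in> A (J c z)" "z = J c z + c *\<^sub>R u" "v \<in> A (J c z')" "z' = J c z' + c *\<^sub>R v"
      using J_graph[OF c] by blast
    then show ?thesis using resolvent_perturbation[OF mono c, of u "J c z" v "J c z'" c] by simp
  qed
  define G where "G t y = y - lam t *\<^sub>R D y - (lam t * \<beta> t) *\<^sub>R B y" for t y
  define F where "F t y = J (lam t) (G t y) - y" for t y
  \<comment> \<open>The 2 counts the identity inside \<open>G\<close> and the term
    \<open>- y\<close> in \<open>F\<close>; the other summands come from the Lipschitz constants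
    \<open>1 / \<eta>\<close> of \<open>D\<close> and \<open>1 / \<mu>\<close> of \<open>B\<close>,
    since the resolvent is nonexpansive.\<close>
  define L where "L t = 2 + lam t / \<eta> + lam t * \<beta> t / \<mu>" for t
  have resolvent_F: "resolvent (scale_op (lam t) A) (y - lam t *\<^sub>R D y - (lam t * \<beta> t) *\<^sub>R B y) = {v + y}
      \<longleftrightarrow> v = F t y" if "t \<ge> 0" for t y v
    using J[OF assms(7)[OF that], of "G t y"] by (auto simp: F_def G_def[symmetric])
  have cont_lam: "continuous_on {0..} lam" and cont_\<beta>: "continuous_on {0..} \<beta>"
    using assms(9,10) by (auto intro: continuous_on_halflineI)
  have contL: "continuous_on {0..} L"
    unfolding L_def using assms(2,4) by (intro continuous_intros cont_lam cont_\<beta>) auto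
  have contF: "continuous_on {0..} (\<lambda>t. F t y)" for y
    unfolding continuous_on_def
  proof
    fix t :: real assume t: "t \<in> {0..}"
    \<comment> \<open>The element \<open>v\<close> belongs to the fixed time \<open>t\<close>, so
      the perturbation bound has a coefficient independent of \<open>s\<close> and tends to 0 as
      \<open>s\<close> approaches \<open>t\<close>.\<close>
    obtain v where v: "v \<in> A (J (lam t) (G t y))" "G t y = J (lam t) (G t y) + lam t *\<^sub>R v"
      using J_graph[of "lam t" "G t y"] assms(7) t by auto
    have "continuous_on {0..} (\<lambda>s. G s y)"
      unfolding G_def by (intro continuous_intros cont_lam cont_\<beta>)
    then have "((\<lambda>s. norm (G s y - G t y) + \<bar>lam t - lam s\<bar> * norm v) \<longlongrightarrow>
        norm (G t y - G t y) + \<bar>lam t - lam t\<bar> * norm v) (at t within {0..})"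
      using cont_lam t by (intro tendsto_intros) (auto simp: continuous_on_def)
    then have "((\<lambda>s. norm (G s y - G t y) + \<bar>lam t - lam s\<bar> * norm v) \<longlongrightarrow> 0) (at t within {0..})"
      by simp
    moreover have "norm (F s y - F t y) \<le> norm (G s y - G t y) + \<bar>lam t - lam s\<bar> * norm v"
      if s: "s \<ge> 0" for s
    proof -
      obtain u where u: "u \<in> A (J (lam s) (G s y))" "G s y = J (lam s) (G s y) + lam s *\<^sub>R u"
        using J_graph[OF assms(7)[OF s], of "G s y"] by blast
      have "norm (J (lam s) (G s y) - J (lam t) (G t y)) \<le> norm (G s y - G t y) + \<bar>lam t - lam s\<bar> * norm v"
        using resolvent_perturbation[OF mono assms(7)[OF s] u(1) v(1), of "lam t", folded u(2) v(2)] .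
      then show ?thesis by (simp add: F_def)
    qed
    ultimately have "((\<lambda>s. F s y - F t y) \<longlongrightarrow> 0) (at t within {0..})"
      by (intro Lim_null_comparison[of "\<lambda>s. F s y - F t y"]) (auto simp: eventually_at_filter)
    then show "((\<lambda>s. F s y) \<longlongrightarrow> F t y) (at t within {0..})" by (rule LIM_zero_cancel)
  qed
  have lip: "norm (F t y - F t z) \<le> L t * norm (y - z)" if t: "t \<ge> 0" for t y z
  proof -
    have pos: "lam t > 0" "\<beta> t > 0" using assms(7,8) t by auto
    have "F t y - F t z = (J (lam t) (G t y) - J (lam t) (G t z)) - (y - z)"
      by (simp add: F_def)
    then have "norm (F t y - F t z) \<le> norm (G t y - G t z) + norm (y - z)"
      using norm_triangle_ineq4[of "J (lam t) (G t y) - J (lam t) (G t z)" "y - z"]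
        J_nonexp[OF pos(1), of "G t y" "G t z"] by simp
    also have "norm (G t y - G t z)
        \<le> norm (y - z) + lam t * norm (D y - D z) + lam t * \<beta> t * norm (B y - B z)"
    proof -
      have "G t y - G t z = (y - z) - lam t *\<^sub>R (D y - D z) - (lam t * \<beta> t) *\<^sub>R (B y - B z)"
        by (simp add: G_def algebra_simps)
      also have "norm \<dots> \<le> norm (y - z) + norm (lam t *\<^sub>R (D y - D z)) + norm ((lam t * \<beta> t) *\<^sub>R (B y - B z))"
        by (meson norm_triangle_ineq4 order_trans add_right_mono)
      finally show ?thesis using pos by simp
    qed
    also have "lam t * norm (D y - D z) \<le> lam t * (norm (y - z) / \<eta>)"
      using pos cocoercive_lipschitz[OF assms(3,2)] by (intro mult_left_mono) auto
    also have "lam t * \<beta> t * norm (B y - B z) \<le> lam t * \<beta> t * (norm (y - z) / \<mu>)"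
      using pos cocoercive_lipschitz[OF assms(5,4)] by (intro mult_left_mono) auto
    finally show ?thesis by (simp add: L_def algebra_simps)
  qed
  have solution_iff: "strong_global_solution A D B lam \<beta> x0 x \<longleftrightarrow> (\<forall>b>0. abs_cont_upto b x) \<and>
      (AE t in lebesgue_on {0..}. (x has_vector_derivative F t (x t)) (at t within {0..})) \<and> x 0 = x0" for x0 x
    unfolding strong_global_solution_def
    by (intro conj_cong refl AE_cong) (auto simp: resolvent_F)
  show ?thesis
  proof
    fix x0
    obtain x where "x 0 = x0"
      and x: "\<And>t. t \<ge> 0 \<Longrightarrow> (x has_vector_derivative F t (x t)) (at t within {0..})"
      using global_picard[OF contF contL lip, of x0] by blast
    have "continuous_on {0..} x" by (rule continuous_on_vector_derivative) (use x in auto)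
    then have "continuous_on {0..} (\<lambda>t. F t (x t))"
      by (intro continuous_on_lipschitz_family[OF contF contL lip]) auto
    then have sol: "strong_global_solution A D B lam \<beta> x0 x"
      unfolding solution_iff using \<open>x 0 = x0\<close> x abs_cont_upto_solution[of x "\<lambda>t. F t (x t)"] by auto
    moreover have "y t = x t" if "strong_global_solution A D B lam \<beta> x0 y" "t \<ge> 0" for y t
      using strong_global_solution_unique[of y F x L t] that sol contL lip
      unfolding solution_iff by auto
    ultimately show "\<exists>x. strong_global_solution A D B lam \<beta> x0 x \<and>
        (\<forall>y. strong_global_solution A D B lam \<beta> x0 y \<longrightarrow> (\<forall>t\<ge>0. y t = x t))" by blast
  qed
qed

end
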